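(* Let $H$ be the Hopf algebra associated to a group datum $(G,\chi,g,1)$ of non-nilpotent type, with central idempotent $e=\frac1r\sum_{s=0}^{r-1}g^{sn}$, index set $\Omega_1$ and modules $P_j$ ($j\in\Omega_1$) as in the context. Then: (1) For any $j\in\Omega_1$, $P_j$ is a simple projective $H(1-e)$-module. (2) Every simple $H(1-e)$-module is isomorphic to $P_j$ for some $j\in\Omega_1$. (3) The subalgebra $H(1-e)$ of $H$ is semisimple. (4) The Jacobson radical of $H$ is the principal (two-sided) ideal generated by the element $ye$.
   Context: $\Bbbk$ is an algebraically closed field of characteristic zero; modules are finite-dimensional left modules. Fix a finite group $G$, a $\Bbbk$-linear character $\chi$ of $G$ and a central element $g\in G$; let $n\ge 2$ be the order of $q=\chi(g)$, and assume $\chi^n=1$ and $g^n\neq 1$. $H$ is the Hopf algebra generated as an algebra by $y$ and $G$, with $\Bbbk G$ as a subalgebra and relations $y^n=g^n-1$, $yh=\chi(h)hy$ for $h\in G$ (with $\Delta(y)=y\otimes g+1\otimes y$ and elements of $G$ group-like). It has $\Bbbk$-basis $\{y^ih\mid h\in G,\ 0\le i\le n-1\}$. The order of $g$ in $G$ is $nr$ with $r>1$; $e$ is a central idempotent of $H$ and $H(1-e)$ is an algebra with unit $1-e$. Let $\{V_i\mid i\in\Omega\}$ be a complete set of simple $\Bbbk G$-modules up to isomorphism; $g^n$ acts on $V_i$ by a nonzero scalar $\lambda_i$, and $\Omega_1=\{i\in\Omega\mid\lambda_i\ne1\}$. For $k\ge0$, $x^kV_i=\{x^kv\mid v\in V_i\}$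 is a copy of the vector space $V_i$ ($x$ a formal variable) with $G$-action $h(x^kv)=\chi^{-k}(h)x^k(hv)$. For $j\in\Omega_1$, $P_j=V_j\oplus xV_j\oplus\cdots\oplus x^{n-1}V_j$ is the $H$-module with this $G$-action and $y(x^kv)=x^{k+1}v$ for $0\le k\le n-2$, $y(x^{n-1}v)=(\lambda_j-1)v$, for $v\in V_j$. The element $e$ acts as $0$ on $P_j$, so $P_j$ is an $H(1-e)$-module. *)

theory Defs
  imports
    "HOL-Algebra.Multiplicative_Group"
    "HOL-Computational_Algebra.Polynomial"
    "HOL-Library.Function_Algebras"
begin

section \<open>Algebras and modules\<close>

text \<open>
  An algebra is a subspace of an ambient ring type with its own unit, so that a corner such as
  \<open>H(1 - e)\<close>, whose unit is not the unit of \<open>H\<close>, is an algebra too. A module is likewise a subspace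
  of an ambient vector space; values of the action outside the two carriers are irrelevant.
\<close>

record ('k, 'a) alg =
  alg_elts :: "'a set"
  alg_unit :: 'a
  alg_scale :: "'k \<Rightarrow> 'a \<Rightarrow> 'a"

record ('k, 'a, 'm) lmod =
  mod_space :: "'m set"
  mod_scale :: "'k \<Rightarrow> 'm \<Rightarrow> 'm"
  mod_act :: "'a \<Rightarrow> 'm \<Rightarrow> 'm"

definition is_algebra :: "('k::field, 'a::ring) alg \<Rightarrow> bool" where
  "is_algebra A \<longleftrightarrow>
     Vector_Spaces.vector_space (alg_scale A) \<and>
     Modules.module.subspace (alg_scale A) (alg_elts A) \<and>
     alg_unit A \<in> alg_elts A \<and>
     (\<forall>a\<in>alg_elts A. alg_unit A * a = a \<and> a * alg_unit A = a) \<and>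
     (\<forall>a\<in>alg_elts A. \<forall>b\<in>alg_elts A. a * b \<in> alg_elts A) \<and>
     (\<forall>c. \<forall>a\<in>alg_elts A. \<forall>b\<in>alg_elts A.
        alg_scale A c a * b = alg_scale A c (a * b) \<and> a * alg_scale A c b = alg_scale A c (a * b))"

definition left_module :: "('k::field, 'a::ring) alg \<Rightarrow> ('k, 'a, 'm::ab_group_add) lmod \<Rightarrow> bool" where
  "left_module A M \<longleftrightarrow>
     is_algebra A \<and>
     Vector_Spaces.vector_space (mod_scale M) \<and>
     Modules.module.subspace (mod_scale M) (mod_space M) \<and>
     (\<forall>a\<in>alg_elts A. \<forall>v\<in>mod_space M. mod_act M a v \<in> mod_space M) \<and>
     (\<forall>a\<in>alg_elts A. \<forall>v\<in>mod_space M. \<forall>w\<in>mod_space M. mod_act M a (v + w) = mod_act M a v + mod_act M a w) \<and>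
     (\<forall>a\<in>alg_elts A. \<forall>b\<in>alg_elts A. \<forall>v\<in>mod_space M. mod_act M (a + b) v = mod_act M a v + mod_act M b v) \<and>
     (\<forall>c. \<forall>a\<in>alg_elts A. \<forall>v\<in>mod_space M.
        mod_act M (alg_scale A c a) v = mod_scale M c (mod_act M a v) \<and>
        mod_act M a (mod_scale M c v) = mod_scale M c (mod_act M a v)) \<and>
     (\<forall>a\<in>alg_elts A. \<forall>b\<in>alg_elts A. \<forall>v\<in>mod_space M. mod_act M (a * b) v = mod_act M a (mod_act M b v)) \<and>
     (\<forall>v\<in>mod_space M. mod_act M (alg_unit A) v = v)"

definition fd_module :: "('k::field, 'a::ring) alg \<Rightarrow> ('k, 'a, 'm::ab_group_add) lmod \<Rightarrow> bool" where
  "fd_module A M \<longleftrightarrow>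
     left_module A M \<and> (\<exists>B. finite B \<and> Modules.module.span (mod_scale M) B = mod_space M)"

definition is_submodule ::
    "('k::field, 'a::ring) alg \<Rightarrow> ('k, 'a, 'm::ab_group_add) lmod \<Rightarrow> 'm set \<Rightarrow> bool" where
  "is_submodule A M N \<longleftrightarrow>
     Modules.module.subspace (mod_scale M) N \<and> N \<subseteq> mod_space M \<and>
     (\<forall>a\<in>alg_elts A. \<forall>v\<in>N. mod_act M a v \<in> N)"

definition simple_module ::
    "('k::field, 'a::ring) alg \<Rightarrow> ('k, 'a, 'm::ab_group_add) lmod \<Rightarrow> bool" where
  "simple_module A M \<longleftrightarrow>
     left_module A M \<and> mod_space M \<noteq> {0} \<and>
     (\<forall>N. is_submodule A M N \<longrightarrow> N = {0} \<or> N = mod_space M)"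

definition mod_hom ::
    "('k::field, 'a::ring) alg \<Rightarrow> ('k, 'a, 'm::ab_group_add) lmod \<Rightarrow>
     ('k, 'a, 'n::ab_group_add) lmod \<Rightarrow> ('m \<Rightarrow> 'n) \<Rightarrow> bool" where
  "mod_hom A M N f \<longleftrightarrow>
     (\<forall>v\<in>mod_space M. f v \<in> mod_space N) \<and>
     (\<forall>v\<in>mod_space M. \<forall>w\<in>mod_space M. f (v + w) = f v + f w) \<and>
     (\<forall>c. \<forall>v\<in>mod_space M. f (mod_scale M c v) = mod_scale N c (f v)) \<and>
     (\<forall>a\<in>alg_elts A. \<forall>v\<in>mod_space M. f (mod_act M a v) = mod_act N a (f v))"

definition mod_iso ::
    "('k::field, 'a::ring) alg \<Rightarrow> ('k, 'a, 'm::ab_group_add) lmod \<Rightarrow>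
     ('k, 'a, 'n::ab_group_add) lmod \<Rightarrow> bool" where
  "mod_iso A M N \<longleftrightarrow> (\<exists>f. mod_hom A M N f \<and> bij_betw f (mod_space M) (mod_space N))"

text \<open>
  The lifting property against arbitrary (not only finite-dimensional) modules. HOL cannot quantify
  over the types carrying the test modules, so they are parameters; a statement that leaves
  \<open>'n\<close> and \<open>'l\<close> as type variables asserts the lifting property for all of them.
\<close>

definition projective_module ::
    "'n::ab_group_add itself \<Rightarrow> 'l::ab_group_add itself \<Rightarrow>
     ('k::field, 'a::ring) alg \<Rightarrow> ('k, 'a, 'm::ab_group_add) lmod \<Rightarrow> bool" where
  "projective_module _ _ A P \<longleftrightarrow>
     left_module A P \<and>
     (\<forall>(N :: ('k, 'a, 'n) lmod) (L :: ('k, 'a, 'l) lmod) p f.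
        left_module A N \<longrightarrow> left_module A L \<longrightarrow>
        mod_hom A N L p \<longrightarrow> p ` mod_space N = mod_space L \<longrightarrow> mod_hom A P L f \<longrightarrow>
        (\<exists>f'. mod_hom A P N f' \<and> (\<forall>v\<in>mod_space P. p (f' v) = f v)))"

definition semisimple_module ::
    "('k::field, 'a::ring) alg \<Rightarrow> ('k, 'a, 'm::ab_group_add) lmod \<Rightarrow> bool" where
  "semisimple_module A M \<longleftrightarrow>
     left_module A M \<and>
     (\<exists>\<S>. finite \<S> \<and>
        (\<forall>S\<in>\<S>. is_submodule A M S \<and> simple_module A (M\<lparr>mod_space := S\<rparr>)) \<and>
        (\<forall>v\<in>mod_space M. \<exists>!f. f \<in> (\<Pi>\<^sub>E S\<in>\<S>. S) \<and> v = (\<Sum>S\<in>\<S>. f S)))"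

definition regular_module :: "('k, 'a::ring) alg \<Rightarrow> ('k, 'a, 'a) lmod" where
  "regular_module A = \<lparr>mod_space = alg_elts A, mod_scale = alg_scale A, mod_act = (*)\<rparr>"

definition semisimple_algebra :: "('k::field, 'a::ring) alg \<Rightarrow> bool" where
  "semisimple_algebra A \<longleftrightarrow> is_algebra A \<and> semisimple_module A (regular_module A)"

definition left_ideal :: "('k::field, 'a::ring) alg \<Rightarrow> 'a set \<Rightarrow> bool" where
  "left_ideal A I \<longleftrightarrow> is_submodule A (regular_module A) I"

definition maximal_left_ideal :: "('k::field, 'a::ring) alg \<Rightarrow> 'a set \<Rightarrow> bool" where
  "maximal_left_ideal A I \<longleftrightarrow>
     left_ideal A I \<and> I \<noteq> alg_elts A \<and>
     (\<forall>J. left_ideal A J \<longrightarrow> I \<subseteq> J \<longrightarrow> J = I \<or> J = alg_elts A)"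

definition jacobson_radical :: "('k::field, 'a::ring) alg \<Rightarrow> 'a set" where
  "jacobson_radical A = alg_elts A \<inter> \<Inter>{I. maximal_left_ideal A I}"

definition two_sided_ideal :: "('k::field, 'a::ring) alg \<Rightarrow> 'a set \<Rightarrow> bool" where
  "two_sided_ideal A I \<longleftrightarrow> left_ideal A I \<and> (\<forall>a\<in>alg_elts A. \<forall>x\<in>I. x * a \<in> I)"

definition principal_ideal :: "('k::field, 'a::ring) alg \<Rightarrow> 'a \<Rightarrow> 'a set" where
  "principal_ideal A z = \<Inter>{I. two_sided_ideal A I \<and> z \<in> I}"

text \<open>
  Completeness has to be tested on a type large enough to carry every finite-dimensional module:
  each finite-dimensional vector space over \<open>'k\<close> is isomorphic to a subspace of \<open>nat \<Rightarrow> 'k\<close>.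
\<close>

definition complete_set_of_simples ::
    "('k::field, 'a::ring) alg \<Rightarrow> 'i set \<Rightarrow> ('i \<Rightarrow> ('k, 'a, 'v::ab_group_add) lmod) \<Rightarrow> bool" where
  "complete_set_of_simples A \<Omega> V \<longleftrightarrow>
     (\<forall>i\<in>\<Omega>. fd_module A (V i) \<and> simple_module A (V i)) \<and>
     (\<forall>i\<in>\<Omega>. \<forall>j\<in>\<Omega>. mod_iso A (V i) (V j) \<longrightarrow> i = j) \<and>
     (\<forall>W :: ('k, 'a, nat \<Rightarrow> 'k) lmod.
        fd_module A W \<and> simple_module A W \<longrightarrow> (\<exists>i\<in>\<Omega>. mod_iso A W (V i)))"


section \<open>The Hopf algebra of a group datum of non-nilpotent type\<close>

text \<open>The group datum \<open>(G, \<chi>, g, 1)\<close> of non-nilpotent type, with \<open>n\<close> the order of \<open>\<chi>(g)\<close>.\<close>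

definition group_datum ::
    "('g, 'b) monoid_scheme \<Rightarrow> ('g \<Rightarrow> 'k::field) \<Rightarrow> 'g \<Rightarrow> nat \<Rightarrow> bool" where
  "group_datum G \<chi> g n \<longleftrightarrow>
     group G \<and> finite (carrier G) \<and>
     (\<forall>h\<in>carrier G. \<chi> h \<noteq> 0) \<and>
     (\<forall>h\<in>carrier G. \<forall>h'\<in>carrier G. \<chi> (h \<otimes>\<^bsub>G\<^esub> h') = \<chi> h * \<chi> h') \<and>
     g \<in> carrier G \<and> (\<forall>h\<in>carrier G. g \<otimes>\<^bsub>G\<^esub> h = h \<otimes>\<^bsub>G\<^esub> g) \<and>
     n \<ge> 2 \<and> \<chi> g ^ n = 1 \<and> (\<forall>m. 0 < m \<and> m < n \<longrightarrow> \<chi> g ^ m \<noteq> 1) \<and>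
     (\<forall>h\<in>carrier G. \<chi> h ^ n = 1) \<and>
     g [^]\<^bsub>G\<^esub> n \<noteq> \<one>\<^bsub>G\<^esub>"

definition whole_alg :: "('k \<Rightarrow> 'a \<Rightarrow> 'a) \<Rightarrow> ('k, 'a::ring_1) alg" where
  "whole_alg sc = \<lparr>alg_elts = UNIV, alg_unit = 1, alg_scale = sc\<rparr>"

text \<open>
  The type \<open>'a\<close> with scalar multiplication \<open>sc\<close> is the underlying algebra of \<open>H\<close>, where
  \<open>\<iota>\<close> is the inclusion of \<open>G\<close>. The relations let every element be written in the monomials
  \<open>y\<^sup>i h\<close>; that these form a basis says that no further relation holds, so \<open>H\<close> is determined up to
  unique isomorphism, and it contains the group algebra. The comultiplication, counit and antipode
  are determined by their values on \<open>y\<close> and \<open>G\<close> and play no role for modules and ideals, so they are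
  not part of the data.
\<close>

definition datum_basis :: "('g, 'b) monoid_scheme \<Rightarrow> nat \<Rightarrow> (nat \<times> 'g) set" where
  "datum_basis G n = {..<n} \<times> carrier G"

definition datum_monomial :: "('g \<Rightarrow> 'a::ring_1) \<Rightarrow> 'a \<Rightarrow> nat \<times> 'g \<Rightarrow> 'a" where
  "datum_monomial \<iota> y = (\<lambda>(i, h). y ^ i * \<iota> h)"

definition datum_algebra ::
    "('g, 'b) monoid_scheme \<Rightarrow> ('g \<Rightarrow> 'k::field) \<Rightarrow> 'g \<Rightarrow> nat \<Rightarrow>
     ('k \<Rightarrow> 'a \<Rightarrow> 'a) \<Rightarrow> ('g \<Rightarrow> 'a) \<Rightarrow> 'a::ring_1 \<Rightarrow> bool" where
  "datum_algebra G \<chi> g n sc \<iota> y \<longleftrightarrow>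
     is_algebra (whole_alg sc) \<and>
     \<iota> \<one>\<^bsub>G\<^esub> = 1 \<and>
     (\<forall>h\<in>carrier G. \<forall>h'\<in>carrier G. \<iota> (h \<otimes>\<^bsub>G\<^esub> h') = \<iota> h * \<iota> h') \<and>
     y ^ n = \<iota> (g [^]\<^bsub>G\<^esub> n) - 1 \<and>
     (\<forall>h\<in>carrier G. y * \<iota> h = sc (\<chi> h) (\<iota> h * y)) \<and>
     inj_on (datum_monomial \<iota> y) (datum_basis G n) \<and>
     \<not> Modules.module.dependent sc (datum_monomial \<iota> y ` datum_basis G n) \<and>
     Modules.module.span sc (datum_monomial \<iota> y ` datum_basis G n) = UNIV"

definition group_alg ::
    "('g, 'b) monoid_scheme \<Rightarrow> ('k::field \<Rightarrow> 'a \<Rightarrow> 'a) \<Rightarrow> ('g \<Rightarrow> 'a::ring_1) \<Rightarrow> ('k, 'a) alg" where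
  "group_alg G sc \<iota> =
     \<lparr>alg_elts = Modules.module.span sc (\<iota> ` carrier G), alg_unit = 1, alg_scale = sc\<rparr>"

definition datum_idem ::
    "('g, 'b) monoid_scheme \<Rightarrow> 'g \<Rightarrow> nat \<Rightarrow> nat \<Rightarrow>
     ('k::field \<Rightarrow> 'a \<Rightarrow> 'a) \<Rightarrow> ('g \<Rightarrow> 'a::ring_1) \<Rightarrow> 'a" where
  "datum_idem G g n r sc \<iota> = sc (1 / of_nat r) (\<Sum>s<r. \<iota> (g [^]\<^bsub>G\<^esub> (s * n)))"

definition corner_alg :: "('k \<Rightarrow> 'a \<Rightarrow> 'a) \<Rightarrow> 'a::ring_1 \<Rightarrow> ('k, 'a) alg" where
  "corner_alg sc u = \<lparr>alg_elts = range (\<lambda>a. a * u), alg_unit = u, alg_scale = sc\<rparr>"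


section \<open>The modules \<open>P\<^sub>j\<close>\<close>

text \<open>
  An element \<open>v\<^sub>0 + x v\<^sub>1 + \<dots> + x\<^bsup>n-1\<^esup> v\<^bsub>n-1\<^esub>\<close> of \<open>V \<oplus> xV \<oplus> \<dots> \<oplus> x\<^bsup>n-1\<^esup>V\<close> is the function
  \<open>k \<mapsto> v\<^sub>k\<close>, extended by \<open>0\<close> to \<open>k \<ge> n\<close>. Below, \<open>l\<close> is the scalar by which \<open>g\<^sup>n\<close> acts on \<open>V\<close>.
\<close>

definition P_h ::
    "('g \<Rightarrow> 'k::field) \<Rightarrow> ('g \<Rightarrow> 'a) \<Rightarrow> ('k, 'a, 'v) lmod \<Rightarrow> 'g \<Rightarrow> (nat \<Rightarrow> 'v) \<Rightarrow> (nat \<Rightarrow> 'v)" where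
  "P_h \<chi> \<iota> V h u = (\<lambda>k. mod_scale V (inverse (\<chi> h) ^ k) (mod_act V (\<iota> h) (u k)))"

definition P_y ::
    "nat \<Rightarrow> ('k::field, 'a, 'v::zero) lmod \<Rightarrow> 'k \<Rightarrow> (nat \<Rightarrow> 'v) \<Rightarrow> (nat \<Rightarrow> 'v)" where
  "P_y n V l u =
     (\<lambda>k. if k = 0 then mod_scale V (l - 1) (u (n - 1)) else if k < n then u (k - 1) else 0)"

text \<open>
  A general element of \<open>H\<close> acts through its coordinates in the basis \<open>y\<^sup>i h\<close>.
\<close>

definition P_mod ::
    "('g, 'b) monoid_scheme \<Rightarrow> ('g \<Rightarrow> 'k::field) \<Rightarrow> nat \<Rightarrow>
     ('k \<Rightarrow> 'a \<Rightarrow> 'a) \<Rightarrow> ('g \<Rightarrow> 'a) \<Rightarrow> 'a::ring_1 \<Rightarrow>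
     ('k, 'a, 'v::ab_group_add) lmod \<Rightarrow> 'k \<Rightarrow> ('k, 'a, nat \<Rightarrow> 'v) lmod" where
  "P_mod G \<chi> n sc \<iota> y V l =
     \<lparr>mod_space = {u. (\<forall>k<n. u k \<in> mod_space V) \<and> (\<forall>k\<ge>n. u k = 0)},
      mod_scale = (\<lambda>c u k. mod_scale V c (u k)),
      mod_act = (\<lambda>a u k. \<Sum>(i, h)\<in>datum_basis G n.
               mod_scale V (Modules.module.representation sc (datum_monomial \<iota> y ` datum_basis G n) a
                         (datum_monomial \<iota> y (i, h)))
                      ((P_y n V l ^^ i) (P_h \<chi> \<iota> V h u) k))\<rparr>"

end

theory Submission
  imports Defs
begin

text \<open>
  With \<open>x = g\<^sup>n\<close>, the element \<open>y\<^sup>n = x - 1\<close> is invertible on \<open>H(1 - e)\<close>, so \<open>y\<close> has an inverse \<open>z\<close> there.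
  As in Maschke's theorem, averaging a linear map over \<open>G\<close> and then over the conjugations by
  \<open>1, y, \<dots>, y\<^bsup>n-1\<^esup>\<close> makes it \<open>H\<close>-linear: \<open>y\<^sup>n\<close> lies in the group algebra, so the second average
  closes up. Hence every \<open>H(1 - e)\<close>-module is projective and submodules have complements.
  The module \<open>P\<^sub>j\<close> is induced from \<open>V\<^sub>j\<close>. It is simple because \<open>g\<close> acts on the summands
  \<open>x\<^sup>kV\<^sub>j\<close> by distinct scalars and \<open>y\<close> permutes them cyclically, and a \<open>V\<^sub>j\<close> inside a simple module
  \<open>M\<close> extends to a nonzero map \<open>P\<^sub>j \<rightarrow> M\<close>.
  Finally \<open>yeH\<close> is a nilpotent ideal, and averaging shows that the quotient by it is semisimple.
\<close>

section \<open>Modules over an algebra\<close>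

text \<open>The central element \<open>x\<close> satisfies \<open>x^r = 1\<close>, and
  \<open>e\<close> is the projection onto its eigenvalue 1; this is why \<open>x - 1\<close> becomes
  invertible exactly when \<open>e\<close> is cut away. The powers of \<open>y\<close> form no
  finite group, so the second average needs its own reason: the sum of the \<open>y^k s z^k\<close>
  commutes with \<open>y\<close> as soon as \<open>s\<close> commutes with \<open>y^n\<close>, and
  that is what the preceding average over \<open>G\<close> achieves. The order of the two averages
  therefore matters. One obstacle is that \<open>y\<close> and the elements of \<open>G\<close> do
  not lie in the corner. Corner modules are regarded as \<open>H\<close>-modules through
  \<open>a \<mapsto> a (1 - e)\<close>, and all averaging takes place there. On \<open>He\<close>
  the element \<open>y\<close> is nilpotent and only the average over \<open>G\<close> is available;
  since \<open>y\<close> maps \<open>He\<close> into \<open>yeH\<close>, the loss of linearity is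
  confined to \<open>yeH\<close>. The scalar by which \<open>g\<close> acts on \<open>V\<close> is
  not given. An n-th root of the scalar of \<open>g^n\<close> supplies candidates, and since
  \<open>\<chi> g\<close> has order exactly \<open>n\<close>, the scalars on the different summands
  \<open>x^k V\<close> are distinct.\<close>

locale left_mod =
  fixes A :: "('k::field, 'a::ring) alg" and M :: "('k, 'a, 'm::ab_group_add) lmod"
  assumes left_module: "left_module A M"
begin

lemma is_algebra: "is_algebra A"
  using left_module by (simp add: left_module_def)

sublocale vector_space "mod_scale M"
  using left_module by (simp add: left_module_def)

lemma subspace_space: "subspace (mod_space M)"
  using left_module by (simp add: left_module_def)

lemmas zero_mem [simp] = subspace_0[OF subspace_space]
  and add_mem [simp] = subspace_add[OF subspace_space]
  and scale_mem [simp] = subspace_scale[OF subspace_space]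
  and diff_mem [simp] = subspace_diff[OF subspace_space]
  and sum_mem = subspace_sum[OF subspace_space]

lemma act_mem [simp]: "a \<in> alg_elts A \<Longrightarrow> v \<in> mod_space M \<Longrightarrow> mod_act M a v \<in> mod_space M"
  using left_module unfolding left_module_def by blast

lemma act_add:
  "a \<in> alg_elts A \<Longrightarrow> v \<in> mod_space M \<Longrightarrow> w \<in> mod_space M \<Longrightarrow>
    mod_act M a (v + w) = mod_act M a v + mod_act M a w"
  using left_module unfolding left_module_def by blast

lemma act_add_left:
  "a \<in> alg_elts A \<Longrightarrow> b \<in> alg_elts A \<Longrightarrow> v \<in> mod_space M \<Longrightarrow>
    mod_act M (a + b) v = mod_act M a v + mod_act M b v"
  using left_module unfolding left_module_def by blast

lemma act_scale_left:
  "a \<in> alg_elts A \<Longrightarrow> v \<in> mod_space M \<Longrightarrow>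
    mod_act M (alg_scale A c a) v = mod_scale M c (mod_act M a v)"
  using left_module unfolding left_module_def by blast

lemma act_scale:
  "a \<in> alg_elts A \<Longrightarrow> v \<in> mod_space M \<Longrightarrow>
    mod_act M a (mod_scale M c v) = mod_scale M c (mod_act M a v)"
  using left_module unfolding left_module_def by blast

lemma act_mult:
  "a \<in> alg_elts A \<Longrightarrow> b \<in> alg_elts A \<Longrightarrow> v \<in> mod_space M \<Longrightarrow>
    mod_act M (a * b) v = mod_act M a (mod_act M b v)"
  using left_module unfolding left_module_def by blast

lemma act_unit [simp]: "v \<in> mod_space M \<Longrightarrow> mod_act M (alg_unit A) v = v"
  using left_module unfolding left_module_def by blast

lemma act_zero [simp]: "a \<in> alg_elts A \<Longrightarrow> mod_act M a 0 = 0"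
  using act_add[of a 0 0] by simp

lemma act_sum:
  assumes "a \<in> alg_elts A" "\<And>i. i \<in> I \<Longrightarrow> f i \<in> mod_space M"
  shows "mod_act M a (\<Sum>i\<in>I. f i) = (\<Sum>i\<in>I. mod_act M a (f i))"
  using assms(2)
proof (induction I rule: infinite_finite_induct)
  case (insert i I)
  then have "(\<Sum>i\<in>I. f i) \<in> mod_space M" by (intro sum_mem) auto
  with insert assms(1) show ?case by (simp add: act_add)
qed (use assms(1) in simp_all)

end

text \<open>The vector-space half of \<open>mod_hom\<close>. Averaging starts from maps that respect
  no action, so the two modules may even belong to different rings.\<close>

definition linear_on ::
    "('k::field, 'a, 'm::ab_group_add) lmod \<Rightarrow> ('k, 'b, 'n::ab_group_add) lmod \<Rightarrow> ('m \<Rightarrow> 'n) \<Rightarrow> bool"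
  where "linear_on M N f \<longleftrightarrow>
     (\<forall>v\<in>mod_space M. f v \<in> mod_space N) \<and>
     (\<forall>v\<in>mod_space M. \<forall>w\<in>mod_space M. f (v + w) = f v + f w) \<and>
     (\<forall>c. \<forall>v\<in>mod_space M. f (mod_scale M c v) = mod_scale N c (f v))"

lemma mod_hom_iff:
  "mod_hom A M N f \<longleftrightarrow>
     linear_on M N f \<and> (\<forall>a\<in>alg_elts A. \<forall>v\<in>mod_space M. f (mod_act M a v) = mod_act N a (f v))"
  unfolding mod_hom_def linear_on_def by blast

lemma linear_onD:
  assumes "linear_on M N f"
  shows "v \<in> mod_space M \<Longrightarrow> f v \<in> mod_space N"
    and "v \<in> mod_space M \<Longrightarrow> w \<in> mod_space M \<Longrightarrow> f (v + w) = f v + f w"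
    and "v \<in> mod_space M \<Longrightarrow> f (mod_scale M c v) = mod_scale N c (f v)"
  using assms by (auto simp: linear_on_def)

lemma linear_on_zero:
  fixes M :: "('k::field, 'a::ring, 'm::ab_group_add) lmod" and N :: "('k, 'b, 'n::ab_group_add) lmod"
  assumes "left_module A M" "linear_on M N f"
  shows "f 0 = 0"
proof -
  interpret M: left_mod A M using assms(1) by unfold_locales
  show ?thesis using linear_onD(2)[OF assms(2), of 0 0] by simp
qed

lemma linear_on_diff:
  fixes M :: "('k::field, 'a::ring, 'm::ab_group_add) lmod" and N :: "('k, 'b, 'n::ab_group_add) lmod"
  assumes "left_module A M" "linear_on M N f" "v \<in> mod_space M" "w \<in> mod_space M"
  shows "f (v - w) = f v - f w"
proof -
  interpret M: left_mod A M using assms(1) by unfold_locales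
  show ?thesis using linear_onD(2)[OF assms(2), of "v - w" w] assms by simp
qed

lemma linear_on_sum:
  fixes M :: "('k::field, 'a::ring, 'm::ab_group_add) lmod" and N :: "('k, 'b, 'n::ab_group_add) lmod"
  assumes "left_module A M" "linear_on M N f" "\<And>i. i \<in> I \<Longrightarrow> v i \<in> mod_space M"
  shows "f (\<Sum>i\<in>I. v i) = (\<Sum>i\<in>I. f (v i))"
  using assms(3)
proof (induction I rule: infinite_finite_induct)
  case (insert i I)
  interpret M: left_mod A M using assms(1) by unfold_locales
  have "(\<Sum>i\<in>I. v i) \<in> mod_space M" using insert by (intro M.sum_mem) auto
  with insert show ?case by (simp add: linear_onD(2)[OF assms(2)])
qed (use linear_on_zero[OF assms(1,2)] in simp_all)

lemma submoduleD:
  assumes "is_submodule A M N"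
  shows "Modules.module.subspace (mod_scale M) N" "N \<subseteq> mod_space M"
    "\<And>a v. a \<in> alg_elts A \<Longrightarrow> v \<in> N \<Longrightarrow> mod_act M a v \<in> N"
  using assms by (auto simp: is_submodule_def)

lemma left_module_submodule:
  assumes "left_module A M" "is_submodule A M N"
  shows "left_module A (M\<lparr>mod_space := N\<rparr>)"
  using assms unfolding left_module_def is_submodule_def by (auto simp: subset_iff)

lemma is_submodule_submodule:
  assumes "is_submodule A M N"
  shows "is_submodule A (M\<lparr>mod_space := N\<rparr>) K \<longleftrightarrow> is_submodule A M K \<and> K \<subseteq> N"
  using assms unfolding is_submodule_def by auto

lemma is_submodule_space: "left_module A M \<Longrightarrow> is_submodule A M (mod_space M)"
  unfolding left_module_def is_submodule_def by auto

lemma is_submodule_Int: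
  assumes "left_module A M" "is_submodule A M N" "is_submodule A M K"
  shows "is_submodule A M (N \<inter> K)"
proof -
  interpret M: left_mod A M using assms(1) by unfold_locales
  show ?thesis using assms(2,3) unfolding is_submodule_def by (auto intro: M.subspace_inter)
qed

lemma is_submodule_sums:
  assumes "left_module A M" "is_submodule A M N" "is_submodule A M K"
  shows "is_submodule A M {v + w | v w. v \<in> N \<and> w \<in> K}"
proof -
  interpret M: left_mod A M using assms(1) by unfold_locales
  show ?thesis unfolding is_submodule_def
  proof (intro conjI ballI)
    show "M.subspace {v + w |v w. v \<in> N \<and> w \<in> K}"
      using assms by (intro M.subspace_sums) (auto simp: is_submodule_def)
    show "{v + w |v w. v \<in> N \<and> w \<in> K} \<subseteq> mod_space M"
      using submoduleD(2)[OF assms(2)] submoduleD(2)[OF assms(3)] by (auto simp: subset_iff)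
    fix a u assume a: "a \<in> alg_elts A" and "u \<in> {v + w |v w. v \<in> N \<and> w \<in> K}"
    then obtain v w where vw: "u = v + w" "v \<in> N" "w \<in> K" by blast
    then have "v \<in> mod_space M" "w \<in> mod_space M"
      using submoduleD(2)[OF assms(2)] submoduleD(2)[OF assms(3)] by auto
    then have "mod_act M a u = mod_act M a v + mod_act M a w"
      using a vw(1) by (simp add: M.act_add)
    moreover have "mod_act M a v \<in> N" "mod_act M a w \<in> K"
      using submoduleD(3)[OF assms(2) a vw(2)] submoduleD(3)[OF assms(3) a vw(3)] by auto
    ultimately show "mod_act M a u \<in> {v + w |v w. v \<in> N \<and> w \<in> K}" by blast
  qed
qed

lemma is_submodule_zero:
  assumes "left_module A M"
  shows "is_submodule A M {0}"
proof -
  interpret M: left_mod A M using assms(1) by unfold_locales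
  show ?thesis unfolding is_submodule_def by auto
qed

lemma is_submodule_preimage:
  assumes M: "left_module A M" and N: "left_module A N" and f: "mod_hom A M N f"
    and K: "is_submodule A N K"
  shows "is_submodule A M {v \<in> mod_space M. f v \<in> K}"
proof -
  interpret M: left_mod A M using M by unfold_locales
  interpret N: left_mod A N using N by unfold_locales
  have lin: "linear_on M N f" and eq: "\<And>a v. a \<in> alg_elts A \<Longrightarrow> v \<in> mod_space M \<Longrightarrow>
      f (mod_act M a v) = mod_act N a (f v)"
    using f by (auto simp: mod_hom_iff)
  note Ks = submoduleD[OF K]
  show ?thesis unfolding is_submodule_def
    by (auto intro!: M.subspaceI simp: linear_on_zero[OF M lin] linear_onD[OF lin] eq
        N.subspace_0[OF Ks(1)] N.subspace_add[OF Ks(1)] N.subspace_scale[OF Ks(1)] Ks(3))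
qed

lemma is_submodule_image:
  assumes M: "left_module A M" and N: "left_module A N" and f: "mod_hom A M N f"
    and K: "is_submodule A M K"
  shows "is_submodule A N (f ` K)"
proof -
  interpret M: left_mod A M using M by unfold_locales
  interpret N: left_mod A N using N by unfold_locales
  have lin: "linear_on M N f" and eq: "\<And>a v. a \<in> alg_elts A \<Longrightarrow> v \<in> mod_space M \<Longrightarrow>
      f (mod_act M a v) = mod_act N a (f v)"
    using f by (auto simp: mod_hom_iff)
  note Ks = submoduleD[OF K]
  have KM: "v \<in> mod_space M" if "v \<in> K" for v using Ks(2) that by auto
  show ?thesis unfolding is_submodule_def
  proof (intro conjI ballI N.subspaceI)
    show "0 \<in> f ` K"
      using M.subspace_0[OF Ks(1)] linear_on_zero[OF M lin] by (metis image_eqI)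
    show "f ` K \<subseteq> mod_space N" using KM linear_onD(1)[OF lin] by auto
    fix x assume "x \<in> f ` K"
    then obtain v where v: "x = f v" "v \<in> K" by auto
    show "mod_scale N c x \<in> f ` K" for c
      using v KM linear_onD(3)[OF lin] M.subspace_scale[OF Ks(1)] by (metis image_eqI)
    show "mod_act N a x \<in> f ` K" if "a \<in> alg_elts A" for a
      using v KM eq[OF that] Ks(3)[OF that] by (metis image_eqI)
    fix x' assume "x' \<in> f ` K"
    then obtain w where w: "x' = f w" "w \<in> K" by auto
    show "x + x' \<in> f ` K"
      using v w KM linear_onD(2)[OF lin] M.subspace_add[OF Ks(1)] by (metis image_eqI)
  qed
qed

lemma mod_hom_inj_on:
  assumes M: "left_module A M" and f: "mod_hom A M N f"
    and ker: "\<And>v. v \<in> mod_space M \<Longrightarrow> f v = 0 \<Longrightarrow> v = 0"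
  shows "inj_on f (mod_space M)"
proof (rule inj_onI)
  interpret M: left_mod A M using M by unfold_locales
  have lin: "linear_on M N f" using f by (simp add: mod_hom_iff)
  fix v w assume "v \<in> mod_space M" "w \<in> mod_space M" "f v = f w"
  then show "v = w"
    using ker[of "v - w"] by (simp add: linear_on_diff[OF M lin])
qed

text \<open>Schur's lemma: kernel and image are submodules, and one nonzero value rules out the
  trivial alternatives.\<close>

lemma schur_bij_betw:
  assumes M: "simple_module A M" and N: "simple_module A N" and f: "mod_hom A M N f"
    and v: "v \<in> mod_space M" "f v \<noteq> 0"
  shows "bij_betw f (mod_space M) (mod_space N)"
proof -
  have lM: "left_module A M" and lN: "left_module A N"
    using M N by (auto simp: simple_module_def)
  interpret M: left_mod A M using lM by unfold_locales
  interpret N: left_mod A N using lN by unfold_locales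
  have "is_submodule A M {v \<in> mod_space M. f v \<in> {0}}"
    by (rule is_submodule_preimage[OF lM lN f is_submodule_zero[OF lN]])
  with M have "{v \<in> mod_space M. f v \<in> {0}} = {0} \<or> {v \<in> mod_space M. f v \<in> {0}} = mod_space M"
    by (simp add: simple_module_def)
  with v have ker: "{v \<in> mod_space M. f v \<in> {0}} = {0}" by auto
  have "inj_on f (mod_space M)"
    by (rule mod_hom_inj_on[OF lM f]) (use ker in auto)
  moreover have "is_submodule A N (f ` mod_space M)"
    by (rule is_submodule_image[OF lM lN f is_submodule_space[OF lM]])
  then have "f ` mod_space M = {0} \<or> f ` mod_space M = mod_space N"
    using N by (simp add: simple_module_def)
  with v have "f ` mod_space M = mod_space N" by auto
  ultimately show ?thesis by (simp add: bij_betw_def)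
qed

lemma mod_hom_the_inv_into:
  assumes M: "left_module A M" and f: "mod_hom A M N f"
    and bij: "bij_betw f (mod_space M) (mod_space N)"
  shows "mod_hom A N M (the_inv_into (mod_space M) f)"
proof -
  interpret M: left_mod A M using M by unfold_locales
  let ?g = "the_inv_into (mod_space M) f"
  have inj: "inj_on f (mod_space M)" using bij by (rule bij_betw_imp_inj_on)
  have g: "?g v \<in> mod_space M" "f (?g v) = v" if "v \<in> mod_space N" for v
    using that bij f_the_inv_into_f_bij_betw[OF bij] bij_betw_apply[OF bij_betw_the_inv_into[OF bij]]
    by auto
  have eqI: "?g x = u" if "u \<in> mod_space M" "f u = x" for u x
    using the_inv_into_f_f[OF inj that(1)] that(2) by simp
  show ?thesis unfolding mod_hom_def
    using g f by (auto intro!: eqI simp: mod_hom_def)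
qed

lemma mod_hom_comp:
  assumes "mod_hom A M N f" "mod_hom A N L h"
  shows "mod_hom A M L (\<lambda>v. h (f v))"
  using assms by (auto simp: mod_hom_def)

lemma mod_iso_sym:
  assumes "left_module A M" "mod_iso A M N"
  shows "mod_iso A N M"
  using assms mod_hom_the_inv_into bij_betw_the_inv_into unfolding mod_iso_def by metis

lemma mod_iso_if_simple:
  assumes "simple_module A M" "simple_module A N" "mod_hom A M N f" "v \<in> mod_space M" "f v \<noteq> 0"
  shows "mod_iso A M N"
  using assms schur_bij_betw[OF assms] unfolding mod_iso_def by blast

text \<open>Preimages of submodules are submodules, and surjectivity recovers a submodule from its
  preimage. This carries simplicity to an isomorphic copy on another type.\<close>

lemma simple_transport:
  assumes M: "simple_module A M" and N: "left_module A N" and f: "mod_hom A M N f"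
    and bij: "bij_betw f (mod_space M) (mod_space N)"
  shows "simple_module A N"
proof -
  have lM: "left_module A M" using M by (auto simp: simple_module_def)
  interpret M: left_mod A M using lM by unfold_locales
  interpret N: left_mod A N using N by unfold_locales
  have im: "f ` mod_space M = mod_space N" using bij by (simp add: bij_betw_def)
  have lin: "linear_on M N f" using f by (simp add: mod_hom_iff)
  have f0: "f 0 = 0" by (rule linear_on_zero[OF lM lin])
  have "mod_space N \<noteq> {0}"
  proof
    assume "mod_space N = {0}"
    then have "f v = f 0" if "v \<in> mod_space M" for v using im f0 that by auto
    then have "mod_space M \<subseteq> {0}"
      using inj_onD[OF bij_betw_imp_inj_on[OF bij]] M.zero_mem by blast
    with M M.zero_mem show False unfolding simple_module_def by blast
  qed
  moreover have "K = {0} \<or> K = mod_space N" if K: "is_submodule A N K" for K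
  proof -
    have "is_submodule A M {v \<in> mod_space M. f v \<in> K}"
      by (rule is_submodule_preimage[OF lM N f K])
    with M have *: "{v \<in> mod_space M. f v \<in> K} = {0} \<or> {v \<in> mod_space M. f v \<in> K} = mod_space M"
      by (simp add: simple_module_def)
    have "K = f ` {v \<in> mod_space M. f v \<in> K}" using submoduleD(2)[OF K] im by auto
    with * show ?thesis using im f0 by auto
  qed
  ultimately show ?thesis using N by (simp add: simple_module_def)
qed

section \<open>Finite dimension\<close>

text \<open>The ambient space may be infinite-dimensional; \<open>T\<close> bounds only the
  subspaces in question. A basis of \<open>U\<close> is extended to one of \<open>W\<close>, and it
  has to grow if \<open>U\<close> is smaller.\<close>

lemma (in vector_space) dim_subset_finite:
  assumes "subspace U" "subspace W" "U \<subseteq> W" "W \<subseteq> span T" "finite T"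
  shows "dim U \<le> dim W" and "U \<noteq> W \<Longrightarrow> dim U < dim W"
proof -
  obtain B where B: "B \<subseteq> U" "independent B" "U \<subseteq> span B" "card B = dim U"
    using basis_exists by metis
  obtain C where C: "B \<subseteq> C" "C \<subseteq> W" "independent C" "W \<subseteq> span C"
    using maximal_independent_subset_extend[of B W] B assms(3) by blast
  have C': "finite C" "card C = dim W"
    using independent_span_bound[OF assms(5) C(3)] C assms(4) basis_card_eq_dim[OF C(2,4,3)] by auto
  then show "dim U \<le> dim W" using C(1) B(4) card_mono by metis
  assume "U \<noteq> W"
  have "B \<noteq> C"
  proof
    assume "B = C"
    with C(4) span_minimal[OF B(1) assms(1)] assms(3) \<open>U \<noteq> W\<close> show False by auto
  qed
  with C(1) have "B \<subset> C" by blast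
  then show "dim U < dim W" using C' B(4) psubset_card_mono by metis
qed

lemma exists_simple_submodule:
  assumes fd: "fd_module A M" and N: "is_submodule A M N" "N \<noteq> {0}"
  shows "\<exists>S. is_submodule A M S \<and> S \<subseteq> N \<and> simple_module A (M\<lparr>mod_space := S\<rparr>)"
proof -
  have M: "left_module A M" using fd by (simp add: fd_module_def)
  interpret M: left_mod A M using M by unfold_locales
  obtain T where T: "finite T" "M.span T = mod_space M" using fd by (auto simp: fd_module_def)
  let ?P = "\<lambda>S. is_submodule A M S \<and> S \<subseteq> N \<and> S \<noteq> {0}"
  \<comment> \<open>A nonzero submodule of least dimension leaves no room for a proper nonzero
    one.\<close>
  obtain S where S: "?P S" and min: "\<And>K. ?P K \<Longrightarrow> M.dim S \<le> M.dim K"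
    using exists_least_iff[of "\<lambda>d. \<exists>S. ?P S \<and> M.dim S = d"] N by (metis not_less subset_refl)
  have "K = {0} \<or> K = S" if K: "is_submodule A M K" "K \<subseteq> S" for K
  proof (rule ccontr)
    assume "\<not> (K = {0} \<or> K = S)"
    then have "M.dim K < M.dim S"
      using K S T submoduleD(1,2) by (intro M.dim_subset_finite(2)[of _ _ T]) (auto simp: is_submodule_def)
    moreover have "?P K" using K S \<open>\<not> (K = {0} \<or> K = S)\<close> by auto
    ultimately show False using min[of K] by simp
  qed
  then have "simple_module A (M\<lparr>mod_space := S\<rparr>)"
    using S M unfolding simple_module_def by (auto simp: left_module_submodule is_submodule_submodule)
  with S show ?thesis by blast
qed

lemma exists_maximal_left_ideal:
  assumes fd: "fd_module A (regular_module A)" and L: "left_ideal A L" "L \<noteq> alg_elts A"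
  shows "\<exists>K. maximal_left_ideal A K \<and> L \<subseteq> K"
proof -
  have R: "left_module A (regular_module A)" using fd by (simp add: fd_module_def)
  interpret R: left_mod A "regular_module A" using R by unfold_locales
  obtain T where T: "finite T" "R.span T = mod_space (regular_module A)"
    using fd by (auto simp: fd_module_def)
  let ?P = "\<lambda>K. left_ideal A K \<and> K \<noteq> alg_elts A \<and> L \<subseteq> K"
  have bound: "R.dim K \<le> card T" if "left_ideal A K" for K
    using that T by (intro R.dim_le_card) (auto simp: left_ideal_def is_submodule_def)
  \<comment> \<open>Dimensions are bounded by \<open>card T\<close>, so there is a proper left ideal
    of largest dimension above \<open>L\<close>; it is maximal.\<close>
  have "\<exists>d. (\<exists>K. ?P K \<and> R.dim K = d) \<and> (\<forall>d'. (\<exists>K. ?P K \<and> R.dim K = d') \<longrightarrow> d' \<le> d)"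
    by (rule Nat.ex_has_greatest_nat[where b = "card T" and k = "R.dim L"])
       (use L bound in auto)
  then obtain K where K: "?P K" and max: "\<And>K'. ?P K' \<Longrightarrow> R.dim K' \<le> R.dim K" by blast
  have "J = K \<or> J = alg_elts A" if J: "left_ideal A J" "K \<subseteq> J" for J
  proof (rule ccontr)
    assume *: "\<not> (J = K \<or> J = alg_elts A)"
    then have "R.dim K < R.dim J"
      using J K T by (intro R.dim_subset_finite(2)[of _ _ T]) (auto simp: left_ideal_def is_submodule_def)
    moreover have "?P J" using K J * by auto
    ultimately show False using max[of J] by simp
  qed
  with K show ?thesis unfolding maximal_left_ideal_def by blast
qed

text \<open>Induction on the dimension, over all submodules \<open>N\<close> of the fixed
  \<open>M\<close>: a simple \<open>S\<close> is split off inside \<open>N\<close>. If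
  \<open>C\<close> complements \<open>S\<close> in \<open>M\<close>, then
  \<open>C \<inter> N\<close> complements \<open>S\<close> in \<open>N\<close> by the modular law,
  so complements are needed in \<open>M\<close> only.\<close>

lemma semisimple_module_if_complements:
  assumes fd: "fd_module A M"
    and compl: "\<And>N. is_submodule A M N \<Longrightarrow>
      \<exists>K. is_submodule A M K \<and> N \<inter> K = {0} \<and> mod_space M \<subseteq> {v + w | v w. v \<in> N \<and> w \<in> K}"
  shows "semisimple_module A M"
proof -
  have M: "left_module A M" using fd by (simp add: fd_module_def)
  interpret M: left_mod A M using M by unfold_locales
  obtain T where T: "finite T" "M.span T = mod_space M" using fd by (auto simp: fd_module_def)
  have *: "\<exists>\<S>. finite \<S> \<and>
        (\<forall>S\<in>\<S>. is_submodule A M S \<and> S \<subseteq> N \<and> simple_module A (M\<lparr>mod_space := S\<rparr>)) \<and>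
        (\<forall>v\<in>N. \<exists>!f. f \<in> (\<Pi>\<^sub>E S\<in>\<S>. S) \<and> v = (\<Sum>S\<in>\<S>. f S))"
    if "is_submodule A M N" for N
    using that
  proof (induction "M.dim N" arbitrary: N rule: less_induct)
    case less
    note N = submoduleD[OF less.prems]
    show ?case
    proof (cases "N = {0}")
      case True
      then show ?thesis by (intro exI[of _ "{}"]) auto
    next
      case False
      obtain S where S: "is_submodule A M S" "S \<subseteq> N" "simple_module A (M\<lparr>mod_space := S\<rparr>)"
        using exists_simple_submodule[OF fd less.prems False] by blast
      have S0: "S \<noteq> {0}" using S(3) by (simp add: simple_module_def)
      obtain C where C: "is_submodule A M C" "S \<inter> C = {0}"
          "mod_space M \<subseteq> {v + w | v w. v \<in> S \<and> w \<in> C}"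
        using compl[OF S(1)] by blast
      have CN: "is_submodule A M (C \<inter> N)"
        by (rule is_submodule_Int[OF M C(1) less.prems])
      have "\<not> S \<subseteq> C" using C(2) S0 by blast
      then have "M.dim (C \<inter> N) < M.dim N"
        using CN N S(2) T by (intro M.dim_subset_finite(2)[of _ _ T]) (auto simp: is_submodule_def)
      note less.hyps[OF this CN]
      then obtain \<S> where \<S>0: "finite \<S>"
        "\<forall>X\<in>\<S>. is_submodule A M X \<and> X \<subseteq> C \<inter> N \<and> simple_module A (M\<lparr>mod_space := X\<rparr>)"
        "\<forall>v\<in>C \<inter> N. \<exists>!f. f \<in> (\<Pi>\<^sub>E X\<in>\<S>. X) \<and> v = (\<Sum>X\<in>\<S>. f X)"
        by (elim exE conjE) (rule that)
      note \<S> = \<S>0(1) bspec[OF \<S>0(2)] bspec[OF \<S>0(3)]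
      \<comment> \<open>The old summands lie in \<open>C\<close> and \<open>S\<close> does not, so
        \<open>S\<close> is a new index.\<close>
      have Sn: "S \<notin> \<S>"
        using \<S>(2)[of S] \<open>\<not> S \<subseteq> C\<close> by blast
      have sumC: "(\<Sum>X\<in>\<S>. f X) \<in> C \<inter> N" if "\<And>X. X \<in> \<S> \<Longrightarrow> f X \<in> X" for f
        using that \<S>(2) by (intro M.subspace_sum[OF submoduleD(1)[OF CN]]) blast
      have "\<exists>!f. f \<in> (\<Pi>\<^sub>E X\<in>insert S \<S>. X) \<and> v = (\<Sum>X\<in>insert S \<S>. f X)" if v: "v \<in> N" for v
      proof -
        obtain a b where ab: "v = a + b" "a \<in> S" "b \<in> C" using C(3) v N(2) by blast
        have "b = v - a" using ab by simp
        then have bN: "b \<in> N" using M.subspace_diff[OF N(1) v] ab(2) S(2) by auto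
        with ab(3) have "\<exists>!f. f \<in> (\<Pi>\<^sub>E X\<in>\<S>. X) \<and> b = (\<Sum>X\<in>\<S>. f X)" by (intro \<S>(3)) simp
        then obtain f where f0: "f \<in> (\<Pi>\<^sub>E X\<in>\<S>. X) \<and> b = (\<Sum>X\<in>\<S>. f X)"
          and uniq0: "\<forall>f'. f' \<in> (\<Pi>\<^sub>E X\<in>\<S>. X) \<and> b = (\<Sum>X\<in>\<S>. f' X) \<longrightarrow> f' = f"
          by (rule ex1E) (rule that)
        note f = conjunct1[OF f0] conjunct2[OF f0]
        have uniq: "f' = f" if "f' \<in> (\<Pi>\<^sub>E X\<in>\<S>. X)" "b = (\<Sum>X\<in>\<S>. f' X)" for f'
          by (rule uniq0[rule_format, OF conjI[OF that]])
        have upd: "(\<Sum>X\<in>\<S>. (f'(S := c)) X) = (\<Sum>X\<in>\<S>. f' X)" for f' :: "'c set \<Rightarrow> 'c" and c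
          using Sn by (intro sum.cong) auto
        show ?thesis
        proof (rule ex1I[of _ "f(S := a)"])
          show "f(S := a) \<in> (\<Pi>\<^sub>E X\<in>insert S \<S>. X) \<and> v = (\<Sum>X\<in>insert S \<S>. (f(S := a)) X)"
            using f ab \<S>(1) Sn upd[of f a] by (auto simp: PiE_def Pi_def extensional_def)
        next
          fix h assume h: "h \<in> (\<Pi>\<^sub>E X\<in>insert S \<S>. X) \<and> v = (\<Sum>X\<in>insert S \<S>. h X)"
          let ?b = "\<Sum>X\<in>\<S>. h X"
          have hS: "h S \<in> S" and hX: "\<And>X. X \<in> \<S> \<Longrightarrow> h X \<in> X" using h by auto
          have v': "v = h S + ?b" using h \<S>(1) Sn by simp
          have bC: "?b \<in> C" using sumC[of h] hX by blast
          \<comment> \<open>One side lies in \<open>S\<close> and the other in \<open>C\<close>, so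
            both vanish.\<close>
          have "a - h S = ?b - b" using v' ab(1) by (simp add: algebra_simps)
          moreover have "a - h S \<in> S" by (rule M.subspace_diff[OF submoduleD(1)[OF S(1)] ab(2) hS])
          moreover have "?b - b \<in> C" by (rule M.subspace_diff[OF submoduleD(1)[OF C(1)] bC ab(3)])
          ultimately have "a - h S \<in> S \<inter> C" by simp
          then have "a - h S = 0" using C(2) by simp
          with \<open>a - h S = ?b - b\<close> have eq: "h S = a" "b = ?b" by simp_all
          \<comment> \<open>Members of the extensional product are \<open>undefined\<close> off
            their index set, so \<open>h\<close> is reset at \<open>S\<close> before uniqueness over
            \<open>\<S>\<close> applies.\<close>
          have "h(S := undefined) = f"
          proof (rule uniq)
            show "h(S := undefined) \<in> (\<Pi>\<^sub>E X\<in>\<S>. X)"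
              using h Sn by (auto simp: PiE_def Pi_def extensional_def)
            show "b = (\<Sum>X\<in>\<S>. (h(S := undefined)) X)" using eq upd[of h undefined] by simp
          qed
          then show "h = f(S := a)" using eq(1) by (metis fun_upd_triv fun_upd_upd)
        qed
      qed
      moreover have "\<forall>X\<in>insert S \<S>. is_submodule A M X \<and> X \<subseteq> N \<and> simple_module A (M\<lparr>mod_space := X\<rparr>)"
        using S \<S>(2) by auto
      ultimately show ?thesis using \<S>(1) by (intro exI[of _ "insert S \<S>"]) auto
    qed
  qed
  show ?thesis unfolding semisimple_module_def
    using *[OF is_submodule_space[OF M]] M by blast
qed

lemma fd_module_submodule:
  assumes fd: "fd_module A M" and N: "is_submodule A M N"
  shows "fd_module A (M\<lparr>mod_space := N\<rparr>)"
proof -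
  have M: "left_module A M" using fd by (simp add: fd_module_def)
  interpret M: left_mod A M using M by unfold_locales
  obtain T where T: "finite T" "M.span T = mod_space M" using fd by (auto simp: fd_module_def)
  obtain B where B: "B \<subseteq> N" "M.independent B" "N \<subseteq> M.span B"
    using M.basis_exists by metis
  have "finite B"
    using M.independent_span_bound[OF T(1) B(2)] B(1) T(2) submoduleD(2)[OF N] by auto
  moreover have "M.span B = N"
    using B M.span_minimal[OF B(1) submoduleD(1)[OF N]] by auto
  ultimately show ?thesis
    unfolding fd_module_def using left_module_submodule[OF M N] by auto
qed

section \<open>Linear maps\<close>

text \<open>Preimages under \<open>p\<close> are chosen on a basis of \<open>P\<close> and extended
  linearly. Averaging later turns such a lift into a module map.\<close>

lemma linear_lift_on:
  assumes N: "left_module A N" and L: "left_module B L" and P: "left_module C P"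
    and p: "linear_on N L p" "p ` mod_space N = mod_space L" and f: "linear_on P L f"
  shows "\<exists>s. linear_on P N s \<and> (\<forall>v\<in>mod_space P. p (s v) = f v)"
proof -
  interpret N: left_mod A N using N by unfold_locales
  interpret L: left_mod B L using L by unfold_locales
  interpret P: left_mod C P using P by unfold_locales
  interpret PN: vector_space_pair "mod_scale P" "mod_scale N" by unfold_locales
  obtain B where B: "B \<subseteq> mod_space P" "P.independent B" "mod_space P \<subseteq> P.span B"
    using P.basis_exists by metis
  have sp: "P.span B = mod_space P"
    using B P.span_minimal[OF B(1) P.subspace_space] by auto
  have "\<exists>w. w \<in> mod_space N \<and> p w = f b" if "b \<in> B" for b
    using p(2) linear_onD(1)[OF f, of b] B(1) that by (metis (no_types, lifting) imageE subsetD)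
  then obtain t where t: "\<And>b. b \<in> B \<Longrightarrow> t b \<in> mod_space N \<and> p (t b) = f b" by metis
  obtain s where s: "Vector_Spaces.linear (mod_scale P) (mod_scale N) s" "\<And>b. b \<in> B \<Longrightarrow> s b = t b"
    using PN.linear_independent_extend[OF B(2), of t] by blast
  interpret s: Vector_Spaces.linear "mod_scale P" "mod_scale N" s by (rule s(1))
  have *: "s v \<in> mod_space N \<and> p (s v) = f v" if "v \<in> mod_space P" for v
  proof -
    have "v \<in> P.span B" using that sp by simp
    then have "v \<in> mod_space P \<and> s v \<in> mod_space N \<and> p (s v) = f v"
    proof (induction rule: P.span_induct_alt)
      case base
      show ?case by (simp add: linear_on_zero[OF N p(1)] linear_on_zero[OF P f])
    next
      case (step c x y)
      then have "x \<in> mod_space P" using B(1) by auto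
      with step t[of x] s(2)[of x] show ?case
        by (simp add: s.add s.scale linear_onD[OF p(1)] linear_onD[OF f])
    qed
    then show ?thesis by simp
  qed
  then have "linear_on P N s" by (simp add: linear_on_def s.add s.scale)
  with * show ?thesis by blast
qed

lemma linear_projection_on:
  assumes M: "left_module A M" and N: "Modules.module.subspace (mod_scale M) N" "N \<subseteq> mod_space M"
  shows "\<exists>p. linear_on M M p \<and> p ` mod_space M \<subseteq> N \<and> (\<forall>v\<in>N. p v = v)"
proof -
  interpret M: left_mod A M using M by unfold_locales
  interpret MM: vector_space_pair "mod_scale M" "mod_scale M" by unfold_locales
  obtain p where p: "range p \<subseteq> N" "Vector_Spaces.linear (mod_scale M) (mod_scale M) p"
      "\<And>v. v \<in> N \<Longrightarrow> p v = v"
    using MM.linear_exists_left_inverse_on[OF M.linear_id N(1)] by auto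
  interpret p: Vector_Spaces.linear "mod_scale M" "mod_scale M" p by (rule p(2))
  show ?thesis
    using p N(2) by (intro exI[of _ p]) (auto simp: linear_on_def p.add p.scale)
qed

text \<open>Completeness of a set of simple modules is tested on the type \<open>nat \<Rightarrow> 'k\<close>, so
  abstract finite-dimensional modules are moved there by choosing a basis.\<close>

lemma fd_module_coordinates:
  fixes M :: "('k::field, 'a::ring, 'm::ab_group_add) lmod"
  assumes fd: "fd_module A M"
  shows "\<exists>(W :: ('k, 'a, nat \<Rightarrow> 'k) lmod) f. fd_module A W \<and> mod_hom A M W f \<and>
    bij_betw f (mod_space M) (mod_space W)"
proof -
  have M: "left_module A M" using fd by (simp add: fd_module_def)
  interpret M: left_mod A M using M by unfold_locales
  obtain T where T: "finite T" "M.span T = mod_space M" using fd by (auto simp: fd_module_def)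
  obtain B where B: "B \<subseteq> mod_space M" "M.independent B" "mod_space M \<subseteq> M.span B"
    using M.basis_exists by metis
  have sp: "M.span B = mod_space M"
    using B M.span_minimal[OF B(1) M.subspace_space] by auto
  have fB: "finite B" using M.independent_span_bound[OF T(1) B(2)] B(1) T(2) by auto
  obtain b where b: "bij_betw b {..<card B} B"
    using ex_bij_betw_nat_finite[OF fB] by (auto simp: atLeast0LessThan)
  define d where "d = card B"
  define R where "R = M.representation B"
  define sc' :: "'k \<Rightarrow> (nat \<Rightarrow> 'k) \<Rightarrow> nat \<Rightarrow> 'k" where "sc' = (\<lambda>c u k. c * u k)"
  define U where "U = {u :: nat \<Rightarrow> 'k. \<forall>k\<ge>d. u k = 0}"
  define f where "f = (\<lambda>v k. if k < d then R v (b k) else 0)"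
  define f' where "f' = (\<lambda>u :: nat \<Rightarrow> 'k. \<Sum>k<d. mod_scale M (u k) (b k))"
  \<comment> \<open>The action is transported through the coordinate map \<open>f\<close> and its
    inverse \<open>f'\<close>, which makes \<open>f\<close> a module map by construction.\<close>
  define W where "W = \<lparr>mod_space = U, mod_scale = sc', mod_act = (\<lambda>a u. f (mod_act M a (f' u)))\<rparr>"
  have vs: "vector_space sc'"
    by unfold_locales (auto simp: sc'_def fun_eq_iff algebra_simps)
  interpret W: vector_space sc' by (rule vs)
  have subU: "W.subspace U" by (rule W.subspaceI) (auto simp: U_def sc'_def)
  have bB: "b k \<in> B" if "k < d" for k using bij_betw_apply[OF b] that by (simp add: d_def)
  have f'_mem: "f' u \<in> mod_space M" for u
    unfolding f'_def using bB B(1) by (intro M.sum_mem M.scale_mem) auto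
  have f'f: "f' (f v) = v" if "v \<in> mod_space M" for v
  proof -
    have "f' (f v) = (\<Sum>k<d. mod_scale M (R v (b k)) (b k))"
      by (simp add: f'_def f_def)
    also have "\<dots> = (\<Sum>x\<in>B. mod_scale M (R v x) x)"
      using sum.reindex_bij_betw[OF b, of "\<lambda>x. mod_scale M (R v x) x"] by (simp add: d_def)
    also have "\<dots> = v"
      unfolding R_def using that sp by (intro M.sum_representation_eq) (auto simp: B fB)
    finally show ?thesis .
  qed
  have f_add: "f (v + w) = f v + f w" if "v \<in> mod_space M" "w \<in> mod_space M" for v w
    using that sp by (auto simp: f_def R_def M.representation_add[OF B(2)] fun_eq_iff)
  have f_scale: "f (mod_scale M c v) = sc' c (f v)" if "v \<in> mod_space M" for v c
    using that sp by (auto simp: f_def R_def M.representation_scale[OF B(2)] fun_eq_iff sc'_def)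
  have f_mem: "f v \<in> U" for v by (simp add: f_def U_def)
  have ff': "f (f' u) = u" if u: "u \<in> U" for u
  proof
    fix k
    show "f (f' u) k = u k"
    proof (cases "k < d")
      case True
      have "R (f' u) = (\<lambda>x. \<Sum>j<d. R (mod_scale M (u j) (b j)) x)"
        unfolding f'_def R_def using bB by (intro M.representation_sum[OF B(2)]) (auto intro: M.span_scale M.span_base)
      then have "R (f' u) (b k) = (\<Sum>j<d. R (mod_scale M (u j) (b j)) (b k))" by simp
      also have "\<dots> = (\<Sum>j<d. u j * R (b j) (b k))"
        unfolding R_def using bB by (intro sum.cong) (auto simp: M.representation_scale[OF B(2)] M.span_base)
      also have "\<dots> = (\<Sum>j<d. if j = k then u j else 0)"
      proof (intro sum.cong refl)
        fix j assume j: "j \<in> {..<d}"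
        then have "b k = b j \<longleftrightarrow> j = k" using True bij_betw_imp_inj_on[OF b] by (auto simp: d_def inj_on_def)
        with j show "u j * R (b j) (b k) = (if j = k then u j else 0)"
          using bB by (auto simp: R_def M.representation_basis[OF B(2)])
      qed
      also have "\<dots> = u k" using True by simp
      finally show ?thesis using True by (simp add: f_def)
    qed (use u in \<open>simp add: f_def U_def\<close>)
  qed
  have f'_add: "f' (u + u') = f' u + f' u'" for u u'
    by (simp add: f'_def M.scale_left_distrib sum.distrib)
  have f'_scale: "f' (sc' c u) = mod_scale M c (f' u)" for c u
    by (simp add: f'_def sc'_def M.scale_sum_right)
  have lW: "left_module A W"
    unfolding left_module_def W_def using M.is_algebra vs subU
    by (simp add: f_mem f'_add f'_scale f'_mem M.act_add f_add M.act_add_left M.act_scale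
        M.act_scale_left f_scale M.act_mult f'f ff')
  have hom: "mod_hom A M W f"
    unfolding mod_hom_def by (simp add: W_def f_mem f_add f_scale f'f)
  have bij: "bij_betw f (mod_space M) (mod_space W)"
    by (rule bij_betw_byWitness[of _ f']) (auto simp: W_def f_mem f'_mem ff' f'f)
  have "W.span (f ` B) = U"
  proof
    show "W.span (f ` B) \<subseteq> U" using f_mem by (intro W.span_minimal subU) auto
    show "U \<subseteq> W.span (f ` B)"
    proof
      fix u assume u: "u \<in> U"
      have "f (f' u) \<in> W.span (f ` B)"
      proof -
        have "f' u \<in> M.span B" using f'_mem sp by simp
        then have "f' u \<in> mod_space M \<and> f (f' u) \<in> W.span (f ` B)"
        proof (induction rule: M.span_induct_alt)
          case base
          have "f 0 = 0" using f_add[of 0 0] by simp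
          then show ?case using W.span_zero[of "f ` B"] by (simp only: M.zero_mem simp_thms)
        next
          case (step c x y)
          then have "x \<in> mod_space M" using B(1) by auto
          moreover have "sc' c (f x) + f y \<in> W.span (f ` B)"
            using step by (intro W.span_add W.span_scale) (auto intro: W.span_base)
          ultimately show ?case
            using step f_add[of "mod_scale M c x" y] f_scale[of x c] by (simp only: M.scale_mem M.add_mem simp_thms)
        qed
        then show ?thesis by simp
      qed
      with ff'[OF u] show "u \<in> W.span (f ` B)" by simp
    qed
  qed
  then have "fd_module A W" unfolding fd_module_def using lW fB by (auto simp: W_def)
  with hom bij show ?thesis by blast
qed

section \<open>The algebra of a group datum\<close>

text \<open>The roots of scalars that algebraic closedness provides enter the later lemmas as
  explicit data.\<close>

locale group_datum_algebra =
  fixes G :: "('g, 'b) monoid_scheme" and \<chi> :: "'g \<Rightarrow> 'k::field_char_0" and g :: 'g and n r :: nat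
    and sc :: "'k \<Rightarrow> 'a::ring_1 \<Rightarrow> 'a" and \<iota> :: "'g \<Rightarrow> 'a" and y :: 'a
  assumes datum: "group_datum G \<chi> g n"
    and ord_g: "group.ord G g = n * r"
    and r_pos: "r > 0"
    and alg: "datum_algebra G \<chi> g n sc \<iota> y"
begin

sublocale group G
  using datum by (simp add: group_datum_def)

sublocale vector_space sc
  using alg by (simp add: datum_algebra_def is_algebra_def whole_alg_def)

lemma finite_G [simp]: "finite (carrier G)"
  and g_in [simp]: "g \<in> carrier G"
  and n_ge: "n \<ge> 2"
  and chi_nonzero [simp]: "h \<in> carrier G \<Longrightarrow> \<chi> h \<noteq> 0"
  and chi_mult: "h \<in> carrier G \<Longrightarrow> h' \<in> carrier G \<Longrightarrow> \<chi> (h \<otimes>\<^bsub>G\<^esub> h') = \<chi> h * \<chi> h'"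
  and g_comm: "h \<in> carrier G \<Longrightarrow> g \<otimes>\<^bsub>G\<^esub> h = h \<otimes>\<^bsub>G\<^esub> g"
  and chi_pow_n: "h \<in> carrier G \<Longrightarrow> \<chi> h ^ n = 1"
  and chi_g_primitive: "0 < m \<Longrightarrow> m < n \<Longrightarrow> \<chi> g ^ m \<noteq> 1"
  using datum unfolding group_datum_def by auto

lemma n_pos [simp]: "0 < n"
  using n_ge by simp

lemma mult_sc [simp]: "sc c a * b = sc c (a * b)" "a * sc c b = sc c (a * b)"
  and iota_one [simp]: "\<iota> \<one>\<^bsub>G\<^esub> = 1"
  and iota_mult: "h \<in> carrier G \<Longrightarrow> h' \<in> carrier G \<Longrightarrow> \<iota> (h \<otimes>\<^bsub>G\<^esub> h') = \<iota> h * \<iota> h'"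
  and y_iota: "h \<in> carrier G \<Longrightarrow> y * \<iota> h = sc (\<chi> h) (\<iota> h * y)"
  and monomial_inj: "inj_on (datum_monomial \<iota> y) (datum_basis G n)"
  and monomial_independent: "independent (datum_monomial \<iota> y ` datum_basis G n)"
  and monomial_span: "span (datum_monomial \<iota> y ` datum_basis G n) = UNIV"
  using alg unfolding datum_algebra_def is_algebra_def whole_alg_def by auto

lemma is_algebra_whole: "is_algebra (whole_alg sc)"
  using alg by (simp add: datum_algebra_def)

lemma whole_alg_sel [simp]:
  "alg_elts (whole_alg sc) = UNIV" "alg_unit (whole_alg sc) = 1" "alg_scale (whole_alg sc) = sc"
  by (simp_all add: whole_alg_def)

lemma chi_one [simp]: "\<chi> \<one>\<^bsub>G\<^esub> = 1"
  using chi_mult[of "\<one>\<^bsub>G\<^esub>" "\<one>\<^bsub>G\<^esub>"] by simp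

lemma iota_inv [simp]:
  "h \<in> carrier G \<Longrightarrow> \<iota> h * \<iota> (inv\<^bsub>G\<^esub> h) = 1" "h \<in> carrier G \<Longrightarrow> \<iota> (inv\<^bsub>G\<^esub> h) * \<iota> h = 1"
  by (simp_all flip: iota_mult)

text \<open>Monomials \<open>y^i \<iota> h\<close> are products of generators and span
  \<open>H\<close>. The zero element is reached as the multiple 0 of \<open>y\<close>.\<close>

lemma generator_induct [case_names iota y add scale mult]:
  assumes "\<And>h. h \<in> carrier G \<Longrightarrow> Q (\<iota> h)" and "Q y"
    and "\<And>a b. Q a \<Longrightarrow> Q b \<Longrightarrow> Q (a + b)" and "\<And>c a. Q a \<Longrightarrow> Q (sc c a)"
    and "\<And>a b. Q a \<Longrightarrow> Q b \<Longrightarrow> Q (a * b)"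
  shows "Q a"
proof -
  have pow: "Q (y ^ i * \<iota> h)" if "h \<in> carrier G" for i h
    by (induction i) (use assms that in \<open>auto simp: mult.assoc\<close>)
  have "a \<in> span (datum_monomial \<iota> y ` datum_basis G n)" using monomial_span by simp
  then show ?thesis
  proof (induction rule: span_induct_alt)
    case base
    show ?case using assms(4)[OF assms(2), of 0] by simp
  next
    case (step c b a)
    then show ?case
      by (auto simp: datum_monomial_def datum_basis_def intro!: assms(3,4) pow)
  qed
qed

lemma y_pow_iota: "h \<in> carrier G \<Longrightarrow> y ^ k * \<iota> h = sc (\<chi> h ^ k) (\<iota> h * y ^ k)"
proof (induction k)
  case (Suc k)
  have "y ^ Suc k * \<iota> h = y * (y ^ k * \<iota> h)" by (simp add: mult.assoc)
  also have "\<dots> = sc (\<chi> h ^ k) (y * \<iota> h * y ^ k)" using Suc by (simp add: mult.assoc)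
  also have "\<dots> = sc (\<chi> h ^ Suc k) (\<iota> h * y ^ Suc k)"
    using Suc.prems by (simp add: y_iota mult.assoc mult.commute)
  finally show ?case .
qed simp

lemma iota_y_pow: "h \<in> carrier G \<Longrightarrow> \<iota> h * y ^ k = sc (inverse (\<chi> h) ^ k) (y ^ k * \<iota> h)"
  by (simp add: y_pow_iota flip: power_mult_distrib)

section \<open>The central idempotent \<open>e\<close> and the inverse of \<open>y\<close> away from
  it\<close>

definition x :: 'a where "x = \<iota> (g [^]\<^bsub>G\<^esub> n)"

text \<open>An inverse of \<open>x - 1\<close> on the corner: as \<open>x^r = 1\<close>, multiplying
  the sum of the terms \<open>s x^s\<close> by \<open>x - 1\<close> telescopes to \<open>r\<close>
  minus the sum of all powers of \<open>x\<close>, that is, to \<open>r (1 - e)\<close>.\<close>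

definition w :: 'a where "w = sc (1 / of_nat r) (\<Sum>s<r. sc (of_nat s) (x ^ s))"

text \<open>From \<open>y^n = x - 1\<close> follows \<open>y z = (x - 1) w = 1 - e\<close>. Since
  \<open>w\<close> has a part in \<open>He\<close>, \<open>z\<close> need not lie in the corner, and
  later formulas carry the factor \<open>1 - e\<close> explicitly.\<close>

definition z :: 'a where "z = y ^ (n - 1) * w"

abbreviation e :: 'a where "e \<equiv> datum_idem G g n r sc \<iota>"

abbreviation H\<^sub>1 :: "('k, 'a) alg" where "H\<^sub>1 \<equiv> corner_alg sc (1 - e)"

lemma y_pow_n: "y ^ n = x - 1"
  using alg by (simp add: datum_algebra_def x_def)

lemma iota_pow: "h \<in> carrier G \<Longrightarrow> \<iota> (h [^]\<^bsub>G\<^esub> (m::nat)) = \<iota> h ^ m"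
  by (induction m) (simp_all add: iota_mult power_commutes)

lemma chi_pow: "h \<in> carrier G \<Longrightarrow> \<chi> (h [^]\<^bsub>G\<^esub> (m::nat)) = \<chi> h ^ m"
  by (induction m) (simp_all add: chi_mult)

lemma x_pow_r: "x ^ r = 1"
  using pow_ord_eq_1[OF g_in] by (simp add: x_def ord_g nat_pow_pow flip: iota_pow)

lemma x_comm: "x * a = a * x"
proof (induction a rule: generator_induct)
  case (iota h)
  have "\<iota> g ^ m * \<iota> h = \<iota> h * \<iota> g ^ m" for m
  proof (rule power_commuting_commutes)
    show "\<iota> g * \<iota> h = \<iota> h * \<iota> g" using iota g_comm[of h] by (simp flip: iota_mult)
  qed
  then show ?case by (simp add: x_def iota_pow)
next
  case y
  have "y * x = sc (\<chi> (g [^]\<^bsub>G\<^esub> n)) (x * y)" by (simp add: x_def y_iota)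
  then show ?case by (simp add: chi_pow chi_pow_n)
qed (simp_all add: algebra_simps, metis mult.assoc)

lemma e_eq: "e = sc (1 / of_nat r) (\<Sum>s<r. x ^ s)"
  by (simp add: datum_idem_def x_def mult.commute nat_pow_pow flip: iota_pow)

lemma x_pow_comm: "x ^ s * a = a * x ^ s"
  by (rule power_commuting_commutes) (rule x_comm)

lemma e_comm: "e * a = a * e"
  by (simp add: e_eq sum_distrib_left sum_distrib_right x_pow_comm)

lemma w_comm: "w * a = a * w"
  by (simp add: w_def sum_distrib_left sum_distrib_right x_pow_comm)

lemma x_e [simp]: "x * e = e"
proof -
  have "x * (\<Sum>s<r. x ^ s) = (\<Sum>s<r. x ^ Suc s)" by (simp add: sum_distrib_left)
  also have "\<dots> = (\<Sum>s<r. x ^ s)"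
    using sum.lessThan_Suc[of "\<lambda>s. x ^ s" r] sum.lessThan_Suc_shift[of "\<lambda>s. x ^ s" r]
    by (simp add: x_pow_r algebra_simps del: sum.lessThan_Suc)
  finally show ?thesis by (simp add: e_eq)
qed

lemma x_pow_e: "x ^ s * e = e"
  by (induction s) (simp_all add: mult.assoc)

lemma e_idem [simp]: "e * e = e"
proof -
  have "e * e = sc (1 / of_nat r) (\<Sum>s<r. x ^ s * e)"
    by (subst (1) e_eq) (simp add: sum_distrib_right)
  also have "\<dots> = sc (1 / of_nat r) (sc (of_nat r) e)" by (simp add: x_pow_e sum_constant_scale del: sum_constant)
  finally show ?thesis using r_pos by simp
qed

lemma e_compl [simp]: "e * (1 - e) = 0" "(1 - e) * e = 0" "(1 - e) * (1 - e) = 1 - e"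
  by (simp_all add: algebra_simps)

lemma e_compl_comm: "(1 - e) * a = a * (1 - e)"
  using e_comm[of a] by (simp add: algebra_simps)

lemma y_pow_n_e: "y ^ n * e = 0"
  by (simp add: y_pow_n algebra_simps)

lemma w_inverse: "(x - 1) * w = 1 - e"
proof -
  obtain r' where r': "r = Suc r'" using r_pos by (cases r) auto
  \<comment> \<open>Summation by parts; at \<open>m = r\<close> the boundary term becomes the scalar
    \<open>r\<close>.\<close>
  have "(x - 1) * (\<Sum>s<m. sc (of_nat s) (x ^ s)) =
      sc (of_nat m) (x ^ m) - (\<Sum>s<m. x ^ Suc s)" for m
    by (induction m) (simp_all add: algebra_simps)
  from this[of r] have "(x - 1) * (\<Sum>s<r. sc (of_nat s) (x ^ s)) =
      sc (of_nat r) 1 - x * (\<Sum>s<r. x ^ s)"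
    by (simp add: x_pow_r sum_distrib_left)
  then have "(x - 1) * w = sc (1 / of_nat r) (sc (of_nat r) 1) - x * e"
    by (simp add: w_def e_eq scale_right_diff_distrib)
  then show ?thesis using r_pos by simp
qed

lemma y_z: "y * z = 1 - e"
proof -
  have "y * z = y ^ n * w"
    unfolding z_def using power_Suc[of y "n - 1"] by (simp flip: mult.assoc)
  then show ?thesis by (simp add: y_pow_n w_inverse)
qed

lemma z_y: "z * y = 1 - e"
proof -
  have "z * y = y ^ (n - 1) * y * w" by (simp add: z_def mult.assoc w_comm)
  also have "\<dots> = y ^ n * w" using power_Suc2[of y "n - 1"] by simp
  finally show ?thesis by (simp add: y_pow_n w_inverse)
qed

text \<open>A consequence of \<open>\<chi>^n = 1\<close>. It makes the return from degree
  \<open>n - 1\<close> to degree 0 compatible with the twist by \<open>\<chi>\<close>, both for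
  \<open>z\<close> and for the operator \<open>y\<close> on \<open>P\<close>.\<close>

lemma inverse_chi_pow:
  assumes h: "h \<in> carrier G"
  shows "inverse (\<chi> h) ^ (n - 1) = \<chi> h"
proof -
  have "\<chi> h ^ (n - 1) * \<chi> h = 1"
    using chi_pow_n[OF h] power_Suc2[of "\<chi> h" "n - 1"] by simp
  then show ?thesis by (metis inverse_unique power_inverse)
qed

lemma z_iota:
  assumes h: "h \<in> carrier G"
  shows "\<iota> h * z = sc (\<chi> h) (z * \<iota> h)"
proof -
  have "\<iota> h * z = \<iota> h * y ^ (n - 1) * w" by (simp add: z_def mult.assoc)
  also have "\<dots> = sc (\<chi> h) (y ^ (n - 1) * \<iota> h * w)" by (simp only: iota_y_pow[OF h] inverse_chi_pow[OF h] mult_sc)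
  also have "\<dots> = sc (\<chi> h) (z * \<iota> h)" by (simp add: z_def mult.assoc w_comm)
  finally show ?thesis .
qed

lemma iota_z_pow: "h \<in> carrier G \<Longrightarrow> \<iota> h * z ^ k = sc (\<chi> h ^ k) (z ^ k * \<iota> h)"
proof (induction k)
  case (Suc k)
  have "\<iota> h * z ^ Suc k = (\<iota> h * z) * z ^ k" by (simp add: mult.assoc)
  also have "\<dots> = sc (\<chi> h) (z * (\<iota> h * z ^ k))" using Suc.prems by (simp add: z_iota mult.assoc)
  finally show ?case using Suc by (simp add: mult.assoc)
qed simp

lemma y_pow_z_pow: "y ^ k * z ^ k * (1 - e) = 1 - e"
proof (induction k)
  case (Suc k)
  have "y ^ Suc k * z ^ Suc k * (1 - e) = y ^ k * (y * z) * z ^ k * (1 - e)"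
    by (simp only: power_Suc2[of y] power_Suc[of z] mult.assoc)
  also have "\<dots> = y ^ k * ((1 - e) * z ^ k) * (1 - e)" by (simp only: y_z mult.assoc)
  also have "\<dots> = y ^ k * z ^ k * ((1 - e) * (1 - e))" by (simp only: e_compl_comm[of "z ^ k"] mult.assoc)
  also have "\<dots> = 1 - e" using Suc by (simp only: e_compl)
  finally show ?case .
qed simp

text \<open>Lets a sum over powers of \<open>z\<close> absorb a factor \<open>y\<close> by an index
  shift; the term with exponent 0 is left to \<open>x_pow_z\<close>.\<close>

lemma z_pow_Suc_y: "z ^ Suc k * (1 - e) * y = z ^ k * (1 - e)"
proof -
  have "z ^ Suc k * (1 - e) * y = z ^ k * (z * y) * (1 - e)"
    by (simp only: power_Suc2 mult.assoc e_compl_comm[of y])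
  then show ?thesis by (simp only: z_y mult.assoc e_compl)
qed

text \<open>The boundary case of the index shift: the surplus \<open>(1 - e) y\<close> is written
  with a factor \<open>y^n\<close>, which lies in the group algebra and so can be moved past a
  \<open>G\<close>-linear map.\<close>

lemma x_pow_z: "y ^ n * (z ^ (n - 1) * (1 - e)) = (1 - e) * y"
proof -
  have "y ^ n * (z ^ (n - 1) * (1 - e)) = y * (y ^ (n - 1) * z ^ (n - 1) * (1 - e))"
    using power_Suc[of y "n - 1"] by (simp add: mult.assoc)
  then show ?thesis by (simp only: y_pow_z_pow e_compl_comm[of y])
qed

section \<open>Averaging linear maps\<close>

lemma iota_closed_submodule:
  assumes M: "left_module (whole_alg sc) M" and N: "Modules.module.subspace (mod_scale M) N" "N \<subseteq> mod_space M"
    and "\<And>h v. h \<in> carrier G \<Longrightarrow> v \<in> N \<Longrightarrow> mod_act M (\<iota> h) v \<in> N"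
    and "\<And>v. v \<in> N \<Longrightarrow> mod_act M y v \<in> N"
  shows "is_submodule (whole_alg sc) M N"
proof -
  interpret M: left_mod "whole_alg sc" M using M by unfold_locales
  have NM: "v \<in> mod_space M" if "v \<in> N" for v using N(2) that by auto
  have "\<forall>v\<in>N. mod_act M a v \<in> N" for a
  proof (induction a rule: generator_induct)
    case (scale c a)
    then show ?case using M.act_scale_left[of a _ c] by (simp add: NM M.subspace_scale[OF N(1)])
  qed (use assms(4,5) in \<open>simp_all add: NM M.act_add_left M.act_mult M.subspace_add[OF N(1)]\<close>)
  then show ?thesis using N by (simp add: is_submodule_def)
qed

lemma mod_hom_if_generators:
  assumes M: "left_module (whole_alg sc) M" and N: "left_module (whole_alg sc) N"
    and f: "linear_on M N f"
    and "\<And>h v. h \<in> carrier G \<Longrightarrow> v \<in> mod_space M \<Longrightarrow> f (mod_act M (\<iota> h) v) = mod_act N (\<iota> h) (f v)"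
    and "\<And>v. v \<in> mod_space M \<Longrightarrow> f (mod_act M y v) = mod_act N y (f v)"
  shows "mod_hom (whole_alg sc) M N f"
proof -
  interpret M: left_mod "whole_alg sc" M using M by unfold_locales
  interpret N: left_mod "whole_alg sc" N using N by unfold_locales
  have "\<forall>v\<in>mod_space M. f (mod_act M a v) = mod_act N a (f v)" for a
  proof (induction a rule: generator_induct)
    case (scale c a)
    then show ?case
      using M.act_scale_left[of a _ c] N.act_scale_left[of a _ c] by (simp add: linear_onD[OF f])
  qed (use assms(4,5) in \<open>simp_all add: linear_onD[OF f] M.act_add_left M.act_mult N.act_add_left N.act_mult\<close>)
  then show ?thesis using f by (simp add: mod_hom_iff)
qed

definition avgG :: "('k, 'a, 'm::ab_group_add) lmod \<Rightarrow> ('k, 'a, 'l::ab_group_add) lmod \<Rightarrow> ('m \<Rightarrow> 'l) \<Rightarrow> 'm \<Rightarrow> 'l"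
  where "avgG M N s v = mod_scale N (1 / of_nat (card (carrier G)))
    (\<Sum>h\<in>carrier G. mod_act N (\<iota> h) (s (mod_act M (\<iota> (inv\<^bsub>G\<^esub> h)) v)))"

text \<open>The element \<open>z\<close> is an inverse of \<open>y\<close> in the corner \<open>H(1 - e)\<close>.\<close>

definition avgY :: "('k, 'a, 'm::ab_group_add) lmod \<Rightarrow> ('k, 'a, 'l::ab_group_add) lmod \<Rightarrow> ('m \<Rightarrow> 'l) \<Rightarrow> 'm \<Rightarrow> 'l"
  where "avgY M N s v = mod_scale N (1 / of_nat n)
    (\<Sum>k<n. mod_act N (y ^ k) (s (mod_act M (z ^ k * (1 - e)) v)))"

lemma order_nonzero: "of_nat (card (carrier G)) \<noteq> (0 :: 'k)"
  using card_gt_0_iff[of "carrier G"] finite_G by auto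

context
  fixes M :: "('k, 'a, 'm::ab_group_add) lmod" and N :: "('k, 'a, 'l::ab_group_add) lmod" and s
  assumes M: "left_module (whole_alg sc) M" and N: "left_module (whole_alg sc) N"
    and s: "linear_on M N s"
begin

interpretation M: left_mod "whole_alg sc" M using M by unfold_locales
interpretation N: left_mod "whole_alg sc" N using N by unfold_locales

lemma linear_on_avgG: "linear_on M N (avgG M N s)"
  unfolding linear_on_def avgG_def
  by (auto intro!: N.sum_mem N.scale_mem simp: linear_onD[OF s] M.act_add N.act_add M.act_scale N.act_scale
      sum.distrib N.scale_right_distrib N.scale_sum_right mult.commute)

lemma linear_on_avgY: "linear_on M N (avgY M N s)"
  unfolding linear_on_def avgY_def
  by (auto intro!: N.sum_mem N.scale_mem simp: linear_onD[OF s] M.act_add N.act_add M.act_scale N.act_scale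
      sum.distrib N.scale_right_distrib N.scale_sum_right mult.commute)

lemma avgG_iota:
  assumes c: "c \<in> carrier G" and v: "v \<in> mod_space M"
  shows "avgG M N s (mod_act M (\<iota> c) v) = mod_act N (\<iota> c) (avgG M N s v)"
proof -
  let ?t = "\<lambda>h. mod_act N (\<iota> h) (s (mod_act M (\<iota> (inv\<^bsub>G\<^esub> h) * \<iota> c) v))"
  have bij: "bij_betw (\<lambda>h. c \<otimes>\<^bsub>G\<^esub> h) (carrier G) (carrier G)"
    by (rule bij_betw_byWitness[of _ "\<lambda>h. inv\<^bsub>G\<^esub> c \<otimes>\<^bsub>G\<^esub> h"]) (use c in \<open>auto simp flip: m_assoc\<close>)
  have "(\<Sum>h\<in>carrier G. ?t h) = (\<Sum>h\<in>carrier G. ?t (c \<otimes>\<^bsub>G\<^esub> h))"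
    by (rule sum.reindex_bij_betw[OF bij, symmetric])
  also have "\<dots> = (\<Sum>h\<in>carrier G. mod_act N (\<iota> c) (mod_act N (\<iota> h) (s (mod_act M (\<iota> (inv\<^bsub>G\<^esub> h)) v))))"
    using c v by (intro sum.cong)
      (auto simp: inv_mult_group iota_mult mult.assoc N.act_mult linear_onD[OF s])
  finally show ?thesis
    using c v by (simp add: avgG_def M.act_mult N.act_sum N.act_scale N.sum_mem linear_onD[OF s])
qed

text \<open>Commutation with \<open>\<iota> h\<close> holds term by term, because the powers of
  \<open>\<chi> h\<close> picked up from \<open>y^k\<close> and \<open>z^k\<close> cancel.
  Commutation with \<open>y\<close> is an index shift that closes up cyclically, because
  \<open>s\<close> commutes with \<open>y^n\<close>.\<close>

lemma avgY_hom:
  assumes G: "\<And>h v. h \<in> carrier G \<Longrightarrow> v \<in> mod_space M \<Longrightarrow> s (mod_act M (\<iota> h) v) = mod_act N (\<iota> h) (s v)"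
  shows "mod_hom (whole_alg sc) M N (avgY M N s)"
proof (rule mod_hom_if_generators[OF M N linear_on_avgY])
  fix h v assume h: "h \<in> carrier G" and v: "v \<in> mod_space M"
  have "mod_act N (y ^ k) (s (mod_act M (z ^ k * (1 - e) * \<iota> h) v)) =
      mod_act N (\<iota> h * y ^ k) (s (mod_act M (z ^ k * (1 - e)) v))" for k
  proof -
    have "z ^ k * (1 - e) * \<iota> h = z ^ k * \<iota> h * (1 - e)" by (simp only: mult.assoc e_compl_comm[of "\<iota> h"])
    also have "\<dots> = sc (inverse (\<chi> h) ^ k) (\<iota> h * z ^ k) * (1 - e)"
      using h by (simp add: iota_z_pow flip: power_mult_distrib)
    also have "\<dots> = sc (inverse (\<chi> h) ^ k) (\<iota> h * (z ^ k * (1 - e)))" by (simp add: mult.assoc)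
    finally have *: "z ^ k * (1 - e) * \<iota> h = \<dots>" .
    have "mod_act N (y ^ k) (s (mod_act M (z ^ k * (1 - e) * \<iota> h) v)) =
      mod_scale N (inverse (\<chi> h) ^ k) (mod_act N (y ^ k * \<iota> h) (s (mod_act M (z ^ k * (1 - e)) v)))"
      using h v M.act_scale_left[of _ v] unfolding *
      by (simp add: M.act_mult N.act_mult linear_onD[OF s] G N.act_scale)
    then show ?thesis
      using h v N.act_scale_left[of _ "s (mod_act M (z ^ k * (1 - e)) v)"]
      by (simp add: iota_y_pow linear_onD[OF s])
  qed
  then show "avgY M N s (mod_act M (\<iota> h) v) = mod_act N (\<iota> h) (avgY M N s v)"
    using v by (simp add: avgY_def N.act_sum N.act_scale N.sum_mem linear_onD[OF s]
        flip: M.act_mult N.act_mult)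
next
  fix v assume v: "v \<in> mod_space M"
  define n' where "n' = n - 1"
  have n': "Suc n' = n" by (simp add: n'_def)
  \<comment> \<open>\<open>x\<close> is the image of a group element, so \<open>s\<close> commutes
    with it; subtraction is reduced to the decomposition of \<open>x\<close> as
    \<open>(x - 1) + 1\<close>.\<close>
  have x: "s (mod_act M (x - 1) u) = mod_act N (x - 1) (s u)" if "u \<in> mod_space M" for u
    using that G[of "g [^]\<^bsub>G\<^esub> n" u] M.act_add_left[of "x - 1" 1 u] N.act_add_left[of "x - 1" 1 "s u"]
      M.act_unit[of u] N.act_unit[of "s u"]
    by (simp add: x_def linear_onD[OF s])
  let ?t = "\<lambda>k. mod_act N (y ^ k) (s (mod_act M (z ^ k * (1 - e)) (mod_act M y v)))"
  have Suc: "?t (Suc k) = mod_act N y (mod_act N (y ^ k) (s (mod_act M (z ^ k * (1 - e)) v)))" for k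
    using v by (simp add: z_pow_Suc_y linear_onD[OF s] flip: M.act_mult N.act_mult del: power_Suc)
       (simp add: linear_onD[OF s] N.act_mult)
  \<comment> \<open>The term \<open>k = 0\<close> becomes \<open>y\<close> applied to the term
    \<open>k = n - 1\<close> of the average at \<open>v\<close>, which is the one the shift leaves
    out.\<close>
  have "?t 0 = s (mod_act M ((1 - e) * y) v)"
    using v N.act_unit[of "s (mod_act M ((1 - e) * y) v)"] by (simp add: M.act_mult linear_onD[OF s])
  also have "\<dots> = s (mod_act M (y ^ n * (z ^ n' * (1 - e))) v)"
    by (simp only: x_pow_z n'_def)
  also have "\<dots> = mod_act N (y ^ n) (s (mod_act M (z ^ n' * (1 - e)) v))"
    unfolding y_pow_n using v M.act_mult[of "x - 1" "z ^ n' * (1 - e)" v] x by simp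
  also have "y ^ n = y * y ^ n'" by (simp flip: n')
  also have "mod_act N (y * y ^ n') (s (mod_act M (z ^ n' * (1 - e)) v)) =
      mod_act N y (mod_act N (y ^ n') (s (mod_act M (z ^ n' * (1 - e)) v)))"
    using v by (simp add: N.act_mult linear_onD[OF s])
  finally have "(\<Sum>k<Suc n'. ?t k) =
      (\<Sum>k<Suc n'. mod_act N y (mod_act N (y ^ k) (s (mod_act M (z ^ k * (1 - e)) v))))"
    unfolding sum.lessThan_Suc_shift[of ?t] Suc sum.lessThan_Suc by (simp only: add.commute)
  then have "(\<Sum>k<n. ?t k) =
      (\<Sum>k<n. mod_act N y (mod_act N (y ^ k) (s (mod_act M (z ^ k * (1 - e)) v))))"
    by (simp only: n')
  then show "avgY M N s (mod_act M y v) = mod_act N y (avgY M N s v)"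
    using v by (simp add: avgY_def N.act_sum N.act_scale N.sum_mem linear_onD[OF s])
qed

end

lemma avgG_fixed:
  assumes "left_module (whole_alg sc) N"
    and "\<And>h. h \<in> carrier G \<Longrightarrow> mod_act N (\<iota> h) (s (mod_act M (\<iota> (inv\<^bsub>G\<^esub> h)) v)) = u"
  shows "avgG M N s v = u"
proof -
  interpret N: left_mod "whole_alg sc" N using assms(1) by unfold_locales
  show ?thesis
    using assms(2) order_nonzero by (simp add: avgG_def N.sum_constant_scale del: sum_constant)
qed

lemma avgY_fixed:
  assumes "left_module (whole_alg sc) N"
    and "\<And>k. mod_act N (y ^ k) (s (mod_act M (z ^ k * (1 - e)) v)) = u"
  shows "avgY M N s v = u"
proof -
  interpret N: left_mod "whole_alg sc" N using assms(1) by unfold_locales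
  show ?thesis
    using assms(2) n_ge by (simp add: avgY_def N.sum_constant_scale del: sum_constant)
qed

lemma avg_hom:
  assumes "left_module (whole_alg sc) M" "left_module (whole_alg sc) N" "linear_on M N s"
  shows "mod_hom (whole_alg sc) M N (avgY M N (avgG M N s))"
  by (rule avgY_hom[OF assms(1,2) linear_on_avgG[OF assms]]) (rule avgG_iota[OF assms])

lemma avgG_mem:
  assumes N: "left_module (whole_alg sc) N" and M: "left_module (whole_alg sc) M"
    and K: "is_submodule (whole_alg sc) N K" and s: "\<And>v. v \<in> mod_space M \<Longrightarrow> s v \<in> K"
    and v: "v \<in> mod_space M"
  shows "avgG M N s v \<in> K"
proof -
  interpret N: left_mod "whole_alg sc" N using N by unfold_locales
  interpret M: left_mod "whole_alg sc" M using M by unfold_locales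
  note K = submoduleD[OF K]
  show ?thesis unfolding avgG_def using v
    by (intro N.subspace_scale[OF K(1)] N.subspace_sum[OF K(1)] K(3) s) auto
qed

lemma avgY_mem:
  assumes N: "left_module (whole_alg sc) N" and M: "left_module (whole_alg sc) M"
    and K: "is_submodule (whole_alg sc) N K" and s: "\<And>v. v \<in> mod_space M \<Longrightarrow> s v \<in> K"
    and v: "v \<in> mod_space M"
  shows "avgY M N s v \<in> K"
proof -
  interpret N: left_mod "whole_alg sc" N using N by unfold_locales
  interpret M: left_mod "whole_alg sc" M using M by unfold_locales
  note K = submoduleD[OF K]
  show ?thesis unfolding avgY_def using v
    by (intro N.subspace_scale[OF K(1)] N.subspace_sum[OF K(1)] K(3) s) auto
qed

text \<open>Averaging commutes with a module map on the target side, so the average of a lift can be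
  compared with the average of the map lifted.\<close>

lemma avgG_comp:
  assumes M: "left_module (whole_alg sc) M" and N: "left_module (whole_alg sc) N"
    and p: "mod_hom (whole_alg sc) N L p" and s: "linear_on M N s" and v: "v \<in> mod_space M"
  shows "p (avgG M N s v) = avgG M L (\<lambda>v. p (s v)) v"
proof -
  interpret N: left_mod "whole_alg sc" N using N by unfold_locales
  interpret M: left_mod "whole_alg sc" M using M by unfold_locales
  have lin: "linear_on N L p" using p by (simp add: mod_hom_iff)
  show ?thesis unfolding avgG_def using v p
    by (simp add: linear_onD[OF lin] linear_on_sum[OF N lin] N.sum_mem linear_onD[OF s])
       (simp add: mod_hom_iff linear_onD[OF s])
qed

lemma avgY_comp:
  assumes M: "left_module (whole_alg sc) M" and N: "left_module (whole_alg sc) N"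
    and p: "mod_hom (whole_alg sc) N L p" and s: "linear_on M N s" and v: "v \<in> mod_space M"
  shows "p (avgY M N s v) = avgY M L (\<lambda>v. p (s v)) v"
proof -
  interpret N: left_mod "whole_alg sc" N using N by unfold_locales
  interpret M: left_mod "whole_alg sc" M using M by unfold_locales
  have lin: "linear_on N L p" using p by (simp add: mod_hom_iff)
  show ?thesis unfolding avgY_def using v p
    by (simp add: linear_onD[OF lin] linear_on_sum[OF N lin] N.sum_mem linear_onD[OF s])
       (simp add: mod_hom_iff linear_onD[OF s])
qed

section \<open>The corner \<open>H(1 - e)\<close>\<close>

lemma corner_alg_sel [simp]:
  "alg_elts H\<^sub>1 = range (\<lambda>a. a * (1 - e))" "alg_unit H\<^sub>1 = 1 - e" "alg_scale H\<^sub>1 = sc"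
  by (simp_all add: corner_alg_def)

lemma mult_compl_assoc: "a * (1 - e) * (b * (1 - e)) = a * b * (1 - e)"
proof -
  have "a * (1 - e) * (b * (1 - e)) = a * ((1 - e) * b) * (1 - e)" by (simp only: mult.assoc)
  also have "\<dots> = a * b * ((1 - e) * (1 - e))" by (simp only: e_compl_comm[of b] mult.assoc)
  finally show ?thesis by (simp only: e_compl)
qed

lemma is_algebra_corner: "is_algebra H\<^sub>1"
  unfolding is_algebra_def
proof (intro conjI ballI allI)
  show "vector_space (alg_scale H\<^sub>1)" by simp unfold_locales
  show "module.subspace (alg_scale H\<^sub>1) (alg_elts H\<^sub>1)"
    by (simp, rule subspaceI) (auto simp flip: distrib_right mult_sc intro: range_eqI[of _ _ 0])
  show "alg_unit H\<^sub>1 \<in> alg_elts H\<^sub>1" by (auto intro!: image_eqI[of _ _ 1])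
  fix a b assume a: "a \<in> alg_elts H\<^sub>1"
  then obtain a' where a': "a = a' * (1 - e)" by auto
  show "alg_unit H\<^sub>1 * a = a" "a * alg_unit H\<^sub>1 = a"
    using mult_compl_assoc[of 1 a'] mult_compl_assoc[of a' 1] a' by simp_all
  assume "b \<in> alg_elts H\<^sub>1"
  then obtain b' where b': "b = b' * (1 - e)" by auto
  show "a * b \<in> alg_elts H\<^sub>1" by (simp only: a' b' mult_compl_assoc) simp
  show "alg_scale H\<^sub>1 c a * b = alg_scale H\<^sub>1 c (a * b)" "a * alg_scale H\<^sub>1 c b = alg_scale H\<^sub>1 c (a * b)"
    for c by simp_all
qed

text \<open>Pullback along the algebra map \<open>a \<mapsto> a (1 - e)\<close> from
  \<open>H\<close> onto the corner. Averaging needs \<open>y\<close> and \<open>\<iota> h\<close> to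
  act, and a corner module by itself says nothing about elements outside the corner.\<close>

definition inflate :: "('k, 'a, 'm) lmod \<Rightarrow> ('k, 'a, 'm) lmod"
  where "inflate M = M\<lparr>mod_act := \<lambda>a. mod_act M (a * (1 - e))\<rparr>"

lemma inflate_sel [simp]:
  "mod_space (inflate M) = mod_space M" "mod_scale (inflate M) = mod_scale M"
  "mod_act (inflate M) a v = mod_act M (a * (1 - e)) v"
  by (simp_all add: inflate_def)

lemma left_module_inflate:
  assumes "left_module H\<^sub>1 M"
  shows "left_module (whole_alg sc) (inflate M)"
proof -
  interpret M: left_mod "H\<^sub>1" M using assms by unfold_locales
  show ?thesis
    unfolding left_module_def
  proof (intro conjI ballI allI)
    show "vector_space (mod_scale (inflate M))" by simp unfold_locales
    show "module.subspace (mod_scale (inflate M)) (mod_space (inflate M))"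
      by (simp add: M.subspace_space)
    fix v c a b assume v: "v \<in> mod_space (inflate M)"
    show "mod_act (inflate M) (alg_unit (whole_alg sc)) v = v"
      using v M.act_unit[of v] by simp
    show "mod_act (inflate M) (alg_scale (whole_alg sc) c a) v = mod_scale (inflate M) c (mod_act (inflate M) a v)"
      using v M.act_scale_left[of "a * (1 - e)" v c] by simp
    show "mod_act (inflate M) (a + b) v = mod_act (inflate M) a v + mod_act (inflate M) b v"
      using v M.act_add_left[of "a * (1 - e)" "b * (1 - e)" v] by (simp add: distrib_right)
    show "mod_act (inflate M) (a * b) v = mod_act (inflate M) a (mod_act (inflate M) b v)"
      using v M.act_mult[of "a * (1 - e)" "b * (1 - e)" v] by (simp only: mult_compl_assoc) simp
  qed (simp_all add: is_algebra_whole M.act_add M.act_scale)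
qed

lemma left_module_corner:
  assumes "left_module (whole_alg sc) M" "\<And>v. v \<in> mod_space M \<Longrightarrow> mod_act M (1 - e) v = v"
  shows "left_module H\<^sub>1 M"
  using assms is_algebra_corner unfolding left_module_def by (simp add: Ball_def)

lemma is_submodule_inflate: "is_submodule (whole_alg sc) (inflate M) N \<longleftrightarrow> is_submodule H\<^sub>1 M N"
  by (auto simp: is_submodule_def)

lemma mod_hom_inflate: "mod_hom (whole_alg sc) (inflate M) (inflate N) f \<longleftrightarrow> mod_hom H\<^sub>1 M N f"
  by (auto simp: mod_hom_def)

lemma linear_on_inflate: "linear_on (inflate M) (inflate N) f \<longleftrightarrow> linear_on M N f"
  by (simp add: linear_on_def)

text \<open>Where \<open>f\<close> already commutes with \<open>H\<close>, every summand of both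
  averages equals \<open>f v\<close>, as \<open>y^k z^k\<close> acts as the identity on an inflated
  module. The stable set \<open>K\<close> serves two uses: a whole module in the lifting problem,
  and a submodule fixed by a projection.\<close>

lemma avg_fixed:
  assumes M: "left_module H\<^sub>1 M" and N: "left_module H\<^sub>1 N"
    and hom: "\<And>a v. v \<in> K \<Longrightarrow> f (mod_act (inflate M) a v) = mod_act (inflate N) a (f v)"
    and K: "\<And>a v. v \<in> K \<Longrightarrow> mod_act (inflate M) a v \<in> K" "K \<subseteq> mod_space M"
      "\<And>v. v \<in> K \<Longrightarrow> f v \<in> mod_space N"
    and v: "v \<in> K"
  shows "avgY (inflate M) (inflate N) (avgG (inflate M) (inflate N) f) v = f v"
proof -
  note M' = left_module_inflate[OF M] and N' = left_module_inflate[OF N]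
  interpret M: left_mod "whole_alg sc" "inflate M" using M' by unfold_locales
  interpret N: left_mod "whole_alg sc" "inflate N" using N' by unfold_locales
  have G: "avgG (inflate M) (inflate N) f u = f u" if u: "u \<in> K" for u
  proof (rule avgG_fixed[OF N'])
    fix h assume h: "h \<in> carrier G"
    have "mod_act (inflate N) (\<iota> h) (f (mod_act (inflate M) (\<iota> (inv\<^bsub>G\<^esub> h)) u)) =
        mod_act (inflate N) (\<iota> h * \<iota> (inv\<^bsub>G\<^esub> h)) (f u)"
      using N.act_mult K(3)[OF u] hom[OF u] by simp
    then show "mod_act (inflate N) (\<iota> h) (f (mod_act (inflate M) (\<iota> (inv\<^bsub>G\<^esub> h)) u)) = f u"
      using h K(3)[OF u] N.act_unit[of "f u"] by simp
  qed
  show ?thesis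
  proof (rule avgY_fixed[OF N'])
    fix k
    have "mod_act (inflate N) (y ^ k) (avgG (inflate M) (inflate N) f (mod_act (inflate M) (z ^ k * (1 - e)) v)) =
       mod_act (inflate N) (y ^ k * (z ^ k * (1 - e))) (f v)"
      using K(1,3)[OF v] hom[OF v] N.act_mult[of "y ^ k" "z ^ k * (1 - e)" "f v"]
      by (simp add: G del: inflate_sel(3))
    also have "\<dots> = mod_act (inflate N) 1 (f v)"
      using y_pow_z_pow[of k] by (simp flip: mult.assoc)
    also have "\<dots> = f v" using N.act_unit[of "f v"] K(3)[OF v] by simp
    finally show "mod_act (inflate N) (y ^ k) (avgG (inflate M) (inflate N) f (mod_act (inflate M) (z ^ k * (1 - e)) v)) = f v" .
  qed
qed

text \<open>The average of a linear lift \<open>s\<close> of \<open>f\<close> is a module map. It is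
  still a lift: \<open>p\<close> commutes with averaging, and averaging leaves the module map
  \<open>f\<close> unchanged.\<close>

lemma projective_module_corner:
  assumes P: "left_module H\<^sub>1 P"
  shows "projective_module TYPE('x::ab_group_add) TYPE('y::ab_group_add) H\<^sub>1 P"
  unfolding projective_module_def
proof (intro conjI allI impI P)
  fix N :: "('k, 'a, 'x) lmod" and L :: "('k, 'a, 'y) lmod" and p f
  assume N: "left_module H\<^sub>1 N" and L: "left_module H\<^sub>1 L" and p: "mod_hom H\<^sub>1 N L p"
    and surj: "p ` mod_space N = mod_space L" and f: "mod_hom H\<^sub>1 P L f"
  obtain s where s: "linear_on P N s" "\<And>v. v \<in> mod_space P \<Longrightarrow> p (s v) = f v"
    using linear_lift_on[OF N L P _ surj, of f] p f by (auto simp: mod_hom_iff)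
  note P' = left_module_inflate[OF P] and N' = left_module_inflate[OF N] and L' = left_module_inflate[OF L]
  interpret P: left_mod "whole_alg sc" "inflate P" using P' by unfold_locales
  let ?G = "avgG (inflate P) (inflate N) s"
  let ?t = "avgY (inflate P) (inflate N) ?G"
  have s': "linear_on (inflate P) (inflate N) s" using s(1) by (simp add: linear_on_inflate)
  have p': "mod_hom (whole_alg sc) (inflate N) (inflate L) p" using p by (simp add: mod_hom_inflate)
  have f': "mod_hom (whole_alg sc) (inflate P) (inflate L) f" using f by (simp add: mod_hom_inflate)
  have G: "p (?G v) = avgG (inflate P) (inflate L) f v" if v: "v \<in> mod_space P" for v
  proof -
    have "p (?G v) = avgG (inflate P) (inflate L) (\<lambda>v. p (s v)) v"
      by (rule avgG_comp[OF P' N' p' s']) (use v in simp)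
    also have "\<dots> = avgG (inflate P) (inflate L) f v"
      unfolding avgG_def using P.act_mem v s(2) by (auto intro!: arg_cong2[where f = "mod_scale _"] sum.cong)
    finally show ?thesis .
  qed
  have "p (?t v) = f v" if v: "v \<in> mod_space P" for v
  proof -
    have "p (?t v) = avgY (inflate P) (inflate L) (\<lambda>v. p (?G v)) v"
      by (rule avgY_comp[OF P' N' p' linear_on_avgG[OF P' N' s']]) (use v in simp)
    also have "\<dots> = avgY (inflate P) (inflate L) (avgG (inflate P) (inflate L) f) v"
      unfolding avgY_def using P.act_mem v G by (auto intro!: arg_cong2[where f = "mod_scale _"] sum.cong)
    also have "\<dots> = f v"
      by (rule avg_fixed[OF P L _ _ _ _ v]) (use f' P.act_mem in \<open>auto simp: mod_hom_iff linear_on_def\<close>)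
    finally show ?thesis .
  qed
  moreover have "mod_hom H\<^sub>1 P N ?t" using avg_hom[OF P' N' s'] by (simp add: mod_hom_inflate)
  ultimately show "\<exists>f'. mod_hom H\<^sub>1 P N f' \<and> (\<forall>v\<in>mod_space P. p (f' v) = f v)" by blast
qed

text \<open>The complement is the kernel of an averaged projection, which still maps into
  \<open>N\<close> and fixes \<open>N\<close>.\<close>

lemma corner_complement:
  assumes M: "left_module H\<^sub>1 M" and N: "is_submodule H\<^sub>1 M N"
  shows "\<exists>K. is_submodule H\<^sub>1 M K \<and> N \<inter> K = {0} \<and> mod_space M \<subseteq> {v + w | v w. v \<in> N \<and> w \<in> K}"
proof -
  interpret M: left_mod "H\<^sub>1" M using M by unfold_locales
  obtain p where p: "linear_on M M p" "p ` mod_space M \<subseteq> N" "\<And>v. v \<in> N \<Longrightarrow> p v = v"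
    using linear_projection_on[OF M submoduleD(1,2)[OF N]] by blast
  note M' = left_module_inflate[OF M]
  have p': "linear_on (inflate M) (inflate M) p" using p(1) by (simp add: linear_on_inflate)
  have N': "is_submodule (whole_alg sc) (inflate M) N" using N by (simp add: is_submodule_inflate)
  define t where "t = avgY (inflate M) (inflate M) (avgG (inflate M) (inflate M) p)"
  have t: "mod_hom H\<^sub>1 M M t"
    using avg_hom[OF M' M' p'] by (simp add: t_def mod_hom_inflate)
  then have lin: "linear_on M M t" by (simp add: mod_hom_iff)
  have tN: "t v \<in> N" if "v \<in> mod_space M" for v
    unfolding t_def using that p(2)
    by (intro avgY_mem[OF M' M' N'] avgG_mem[OF M' M' N']) auto
  have tid: "t v = v" if v: "v \<in> N" for v
  proof -
    have "t v = p v" unfolding t_def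
      by (rule avg_fixed[OF M M _ _ _ _ v])
        (use p(3) submoduleD(2)[OF N] submoduleD(3)[OF N'] in \<open>auto simp del: inflate_sel(3)\<close>)
    with p(3)[OF v] show ?thesis by simp
  qed
  let ?K = "{v \<in> mod_space M. t v \<in> {0}}"
  have "is_submodule H\<^sub>1 M ?K"
    by (rule is_submodule_preimage[OF M M t is_submodule_zero[OF M]])
  moreover have "N \<inter> ?K = {0}"
    using tid M.subspace_0[OF submoduleD(1)[OF N]] by auto
  moreover have "v \<in> {v + w | v w. v \<in> N \<and> w \<in> ?K}" if v: "v \<in> mod_space M" for v
  proof -
    have tv: "t v \<in> mod_space M" using tN[OF v] submoduleD(2)[OF N] by auto
    have "t (v - t v) = 0" using linear_on_diff[OF M lin v tv] tid[OF tN[OF v]] by simp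
    then have "v - t v \<in> ?K" using v tv by simp
    moreover have "v = t v + (v - t v)" by simp
    ultimately show ?thesis using tN[OF v] by blast
  qed
  ultimately show ?thesis by blast
qed

lemma regular_module_sel [simp]:
  "mod_space (regular_module A) = alg_elts A" "mod_scale (regular_module A) = alg_scale A"
  "mod_act (regular_module A) = (*)"
  by (simp_all add: regular_module_def)

lemma left_module_regular: "is_algebra A \<Longrightarrow> left_module A (regular_module A)"
  unfolding left_module_def is_algebra_def by (simp add: algebra_simps)

lemma finite_monomials: "finite (datum_monomial \<iota> y ` datum_basis G n)"
  by (simp add: datum_basis_def)

lemma fd_regular_whole: "fd_module (whole_alg sc) (regular_module (whole_alg sc))"
  unfolding fd_module_def
  using left_module_regular[OF is_algebra_whole] monomial_span finite_monomials by auto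

lemma fd_regular_corner: "fd_module H\<^sub>1 (regular_module H\<^sub>1)"
proof -
  let ?f = "\<lambda>a. a * (1 - e)"
  interpret f: Vector_Spaces.linear sc sc ?f
    by unfold_locales (simp_all add: distrib_right)
  have "span (?f ` datum_monomial \<iota> y ` datum_basis G n) = range ?f"
    unfolding f.span_image monomial_span ..
  then show ?thesis
    unfolding fd_module_def
    by (intro conjI left_module_regular[OF is_algebra_corner]
        exI[of _ "?f ` datum_monomial \<iota> y ` datum_basis G n"])
      (simp_all add: finite_monomials)
qed

lemma semisimple_corner: "semisimple_algebra H\<^sub>1"
  unfolding semisimple_algebra_def
  by (intro conjI is_algebra_corner semisimple_module_if_complements[OF fd_regular_corner]
      corner_complement left_module_regular)

section \<open>The Jacobson radical\<close>

abbreviation R :: "('k, 'a, 'a) lmod" where "R \<equiv> regular_module (whole_alg sc)"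

text \<open>One half of the normality of \<open>y\<close>: \<open>H y\<close> lies in
  \<open>y H\<close>. This makes the right ideal \<open>y e H\<close> two-sided.\<close>

lemma y_mult_ex: "\<exists>a'. a * y = y * a'"
proof (induction a rule: generator_induct)
  case (iota h)
  then show ?case
    by (intro exI[of _ "sc (inverse (\<chi> h)) (\<iota> h)"]) (simp add: y_iota)
next
  case (add a b)
  then obtain a' b' where "a * y = y * a'" "b * y = y * b'" by blast
  then have "(a + b) * y = y * (a' + b')" by (simp add: distrib_left distrib_right)
  then show ?case ..
next
  case (scale c a)
  then obtain a' where "a * y = y * a'" by blast
  then have "sc c a * y = y * sc c a'" by simp
  then show ?case ..
next
  case (mult a b)
  then obtain a' b' where *: "a * y = y * a'" "b * y = y * b'" by blast
  have "a * b * y = a * y * b'" by (simp only: *(2) mult.assoc)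
  also have "\<dots> = y * (a' * b')" unfolding *(1) by (simp only: mult.assoc)
  finally show ?case ..
qed blast

lemma left_ideal_y_e: "left_ideal (whole_alg sc) (range (\<lambda>a. y * e * a))"
  unfolding left_ideal_def is_submodule_def
proof (intro conjI ballI)
  show "module.subspace (mod_scale R) (range (\<lambda>a. y * e * a))"
  proof (simp, rule subspaceI)
    show "0 \<in> range (\<lambda>a. y * e * a)" by (rule range_eqI[of _ _ 0]) simp
    show "b + c \<in> range (\<lambda>a. y * e * a)" if "b \<in> range (\<lambda>a. y * e * a)" "c \<in> range (\<lambda>a. y * e * a)" for b c
      using that by (auto simp flip: distrib_left)
    show "sc c b \<in> range (\<lambda>a. y * e * a)" if "b \<in> range (\<lambda>a. y * e * a)" for b c
      using that by (auto simp: mult_sc(2)[symmetric] simp del: mult_sc)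
  qed
  fix c b assume "b \<in> range (\<lambda>a. y * e * a)"
  then obtain a where a: "b = y * e * a" by auto
  obtain c' where "c * y = y * c'" using y_mult_ex by blast
  then have "c * b = y * (c' * e) * a" by (simp add: a flip: mult.assoc)
  also have "\<dots> = y * e * (c' * a)" by (simp only: e_comm[of c', symmetric] mult.assoc)
  finally show "mod_act R c b \<in> range (\<lambda>a. y * e * a)" by simp
qed simp

lemma principal_ideal_y_e: "principal_ideal (whole_alg sc) (y * e) = range (\<lambda>a. y * e * a)"
proof
  have "two_sided_ideal (whole_alg sc) (range (\<lambda>a. y * e * a))"
    using left_ideal_y_e by (auto simp: two_sided_ideal_def mult.assoc)
  moreover have "y * e \<in> range (\<lambda>a. y * e * a)" by (rule range_eqI[of _ _ 1]) simp
  ultimately show "principal_ideal (whole_alg sc) (y * e) \<subseteq> range (\<lambda>a. y * e * a)"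
    unfolding principal_ideal_def by blast
  show "range (\<lambda>a. y * e * a) \<subseteq> principal_ideal (whole_alg sc) (y * e)"
    unfolding principal_ideal_def two_sided_ideal_def by auto
qed

text \<open>All factors \<open>y\<close> can be collected on the left, and
  \<open>y^n e = (x - 1) e = 0\<close>.\<close>

lemma y_e_nilpotent: "(y * e * a) ^ Suc n = 0"
proof -
  have "\<exists>b. (y * e * a) ^ m * e = y ^ m * e * b" for m
  proof (induction m)
    case 0
    show ?case by (intro exI[of _ 1]) simp
  next
    case (Suc m)
    then obtain b where b: "(y * e * a) ^ m * e = y ^ m * e * b" ..
    obtain b' where b': "b * y = y * b'" using y_mult_ex by blast
    have "(y * e * a) ^ Suc m * e = (y * e * a) ^ m * (e * y) * a * e"
      by (simp only: power_Suc2 mult.assoc e_comm[of y])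
    also have "\<dots> = y ^ m * e * (b * y) * a * e" by (simp only: b mult.assoc[symmetric])
    also have "\<dots> = y ^ m * (e * y) * b' * a * e" by (simp only: b' mult.assoc)
    also have "\<dots> = y ^ Suc m * e * (b' * a * e)"
      by (simp only: power_Suc2 mult.assoc e_comm[of y])
    finally show ?case ..
  qed
  then obtain b where b: "(y * e * a) ^ n * e = y ^ n * e * b" by blast
  \<comment> \<open>The last factor supplies the \<open>e\<close> on the right that the claim about
    the n-th power asks for.\<close>
  have "(y * e * a) ^ Suc n = (y * e * a) ^ n * (e * y) * a"
    by (simp only: power_Suc2 mult.assoc e_comm[of y])
  also have "\<dots> = y ^ n * e * b * y * a" by (simp only: b mult.assoc[symmetric])
  finally show ?thesis by (simp add: y_pow_n_e)
qed

lemma left_module_R: "left_module (whole_alg sc) R"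
  by (rule left_module_regular[OF is_algebra_whole])

text \<open>If a maximal left ideal \<open>L\<close> did not contain the nilpotent ideal, then
  \<open>1 = y e a + l\<close> with \<open>l \<in> L\<close>. A finite geometric sum is a left
  inverse of \<open>l = 1 - y e a\<close>, which forces \<open>1 \<in> L\<close>.\<close>

lemma y_e_subset_jacobson: "range (\<lambda>a. y * e * a) \<subseteq> jacobson_radical (whole_alg sc)"
  unfolding jacobson_radical_def
proof (intro Int_greatest Inter_greatest subsetI)
  fix L c assume "L \<in> {I. maximal_left_ideal (whole_alg sc) I}" and c: "c \<in> range (\<lambda>a. y * e * a)"
  then have L: "is_submodule (whole_alg sc) R L" "L \<noteq> UNIV"
    and max: "\<And>J. is_submodule (whole_alg sc) R J \<Longrightarrow> L \<subseteq> J \<Longrightarrow> J = L \<or> J = UNIV"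
    by (auto simp: maximal_left_ideal_def left_ideal_def)
  let ?I = "range (\<lambda>a. y * e * a)"
  let ?J = "{v + w | v w. v \<in> ?I \<and> w \<in> L}"
  have I: "is_submodule (whole_alg sc) R ?I" using left_ideal_y_e by (simp add: left_ideal_def)
  have sub: "subspace L" "subspace ?I" using submoduleD(1)[OF L(1)] submoduleD(1)[OF I] by simp_all
  have "L \<subseteq> ?J" using subspace_0[OF sub(2)] by (metis (mono_tags, lifting) add_0 mem_Collect_eq subsetI)
  then have "?J = L \<or> ?J = UNIV"
    by (rule max[OF is_submodule_sums[OF left_module_R I L(1)]])
  moreover have "?J \<noteq> UNIV"
  proof
    assume "?J = UNIV"
    then have "1 \<in> ?J" by simp
    then obtain a l where l: "1 = y * e * a + l" "l \<in> L" by blast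
    have geo: "(\<Sum>i<m. b ^ i) * (1 - b) = 1 - b ^ m" for m and b :: 'a
    proof (induction m)
      case (Suc m)
      have "(\<Sum>i<Suc m. b ^ i) * (1 - b) = (1 - b ^ m) + b ^ m * (1 - b)"
        using Suc by (simp only: sum.lessThan_Suc distrib_right)
      then show ?case by (simp add: right_diff_distrib power_commutes)
    qed simp
    have "(\<Sum>i<Suc n. (y * e * a) ^ i) * (1 - y * e * a) = 1"
      unfolding geo y_e_nilpotent by simp
    moreover have "1 - y * e * a = l" using l(1) by (metis add_diff_cancel_left')
    ultimately have "1 \<in> L" using submoduleD(3)[OF L(1) _ l(2)] by (metis UNIV_I regular_module_sel(3) whole_alg_sel(1))
    then have "a \<in> L" for a using submoduleD(3)[OF L(1), of a 1] by simp
    with L(2) show False by blast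
  qed
  ultimately have "?J = L" by blast
  moreover have "c \<in> ?J" using c subspace_0[OF sub(1)] by (metis (mono_tags, lifting) add.right_neutral mem_Collect_eq)
  ultimately show "c \<in> L" by blast
qed simp

text \<open>A projection onto the radical \<open>J\<close> is averaged over \<open>G\<close> on \<open>He\<close> and over \<open>G\<close> and \<open>y\<close>
  on \<open>H(1 - e)\<close>. The result is \<open>H\<close>-linear only modulo \<open>yeH\<close>, which is enough for the
  preimage of \<open>yeH\<close> to be a left ideal \<open>K\<close> with \<open>K + J = H\<close>. As \<open>J\<close> is contained in all
  maximal left ideals, \<open>K = H\<close>.\<close>

lemma jacobson_subset_y_e: "jacobson_radical (whole_alg sc) \<subseteq> range (\<lambda>a. y * e * a)"
proof -
  define J where "J = jacobson_radical (whole_alg sc)"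
  define I where "I = range (\<lambda>a. y * e * a)"
  have IJ: "I \<subseteq> J" unfolding I_def J_def by (rule y_e_subset_jacobson)
  have subI: "is_submodule (whole_alg sc) R I" using left_ideal_y_e by (simp add: left_ideal_def I_def)
  have subJ: "is_submodule (whole_alg sc) R J"
    unfolding J_def jacobson_radical_def is_submodule_def
    by (auto simp: maximal_left_ideal_def left_ideal_def is_submodule_def intro!: subspace_Inter)
  note I = submoduleD[OF subI, simplified] and J = submoduleD[OF subJ, simplified]
  obtain p where p: "linear_on R R p" "\<And>v. p v \<in> J" "\<And>v. v \<in> J \<Longrightarrow> p v = v"
    using linear_projection_on[OF left_module_R, of J] J(1) by auto
  define P where "P = avgG R R p"
  define Q where "Q = avgY R R P"
  have P: "linear_on R R P" unfolding P_def by (rule linear_on_avgG[OF left_module_R left_module_R p(1)])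
  have P_iota: "P (\<iota> h * v) = \<iota> h * P v" if "h \<in> carrier G" for h v
    using avgG_iota[OF left_module_R left_module_R p(1) that, of v] by (simp add: P_def)
  have Q: "mod_hom (whole_alg sc) R R Q"
    unfolding Q_def P_def by (rule avg_hom[OF left_module_R left_module_R p(1)])
  have Q_lin: "linear_on R R Q" using Q by (simp add: mod_hom_iff)
  have Q_mult: "Q (a * v) = a * Q v" for a v using Q by (simp add: mod_hom_iff)
  have P_mem: "P v \<in> J" for v
    unfolding P_def by (rule avgG_mem[OF left_module_R left_module_R subJ]) (simp_all add: p)
  have Q_mem: "Q v \<in> J" for v
    unfolding Q_def by (rule avgY_mem[OF left_module_R left_module_R subJ]) (simp_all add: P_mem)
  have P_J: "P v = v" if v: "v \<in> J" for v
    unfolding P_def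
  proof (rule avgG_fixed[OF left_module_R])
    fix h assume "h \<in> carrier G"
    then show "mod_act R (\<iota> h) (p (mod_act R (\<iota> (inv\<^bsub>G\<^esub> h)) v)) = v"
      using p(3)[OF J(3)[OF v]] by (simp flip: mult.assoc)
  qed
  \<comment> \<open>\<open>Q\<close> sees only the corner part of its argument, so on
    \<open>J\<close> it is multiplication by \<open>1 - e\<close>; the summand
    \<open>P (e * v)\<close> of \<open>t\<close> supplies the rest.\<close>
  have Q_J: "Q v = (1 - e) * v" if "v \<in> J" for v
  proof -
    have "y ^ k * (z ^ k * (1 - e) * v) = (1 - e) * v" for k
      unfolding mult.assoc[symmetric] y_pow_z_pow ..
    then show ?thesis
      unfolding Q_def using that by (intro avgY_fixed[OF left_module_R]) (simp add: P_J J(3))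
  qed
  have P_e: "P (e * v) = e * P v" for v
  proof -
    have "P (e * v) = sc (1 / of_nat r) (P (\<Sum>s<r. \<iota> (g [^]\<^bsub>G\<^esub> (s * n)) * v))"
      using linear_onD(3)[OF P] by (simp add: datum_idem_def sum_distrib_right)
    also have "P (\<Sum>s<r. \<iota> (g [^]\<^bsub>G\<^esub> (s * n)) * v) = (\<Sum>s<r. \<iota> (g [^]\<^bsub>G\<^esub> (s * n)) * P v)"
      using linear_on_sum[OF left_module_R P, of "{..<r}" "\<lambda>s. \<iota> (g [^]\<^bsub>G\<^esub> (s * n)) * v"]
      by (simp add: P_iota)
    finally show ?thesis by (simp add: datum_idem_def sum_distrib_right)
  qed
  define t where "t = (\<lambda>v. P (e * v) + Q v)"
  have t_add: "t (u + v) = t u + t v" for u v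
    using linear_onD(2)[OF P] linear_onD(2)[OF Q_lin] by (simp add: t_def distrib_left)
  have t_scale: "t (sc c v) = sc c (t v)" for c v
    using linear_onD(3)[OF P] linear_onD(3)[OF Q_lin] by (simp add: t_def scale_right_distrib)
  have t_J: "t v = v" if "v \<in> J" for v
    using that J(3) by (simp add: t_def P_J Q_J algebra_simps)
  have t_mem: "t v \<in> J" for v
    using subspace_add[OF J(1) P_mem Q_mem] by (simp add: t_def)
  define K where "K = {v. t v \<in> I}"
  have "subspace K"
    unfolding K_def
  proof (rule subspaceI)
    show "0 \<in> {v. t v \<in> I}" using t_scale[of 0 0] subspace_0[OF I(1)] by simp
  qed (simp_all add: t_add t_scale subspace_add[OF I(1)] subspace_scale[OF I(1)])
  moreover have "\<iota> h * v \<in> K" if "h \<in> carrier G" "v \<in> K" for h v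
  proof -
    have "e * (\<iota> h * v) = \<iota> h * (e * v)" by (simp add: e_comm[of "\<iota> h"] flip: mult.assoc)
    then have "t (\<iota> h * v) = \<iota> h * t v" using that(1) by (simp add: t_def P_iota Q_mult distrib_left)
    with that(2) I(3) show ?thesis by (simp add: K_def)
  qed
  moreover have "y * v \<in> K" if "v \<in> K" for v
  proof -
    have mem: "y * e * a \<in> I" for a by (simp add: I_def)
    \<comment> \<open>\<open>y e v\<close> lies in \<open>I\<close> and hence in \<open>J\<close>,
      where \<open>P\<close> is the identity. The defect of \<open>t\<close> with respect to
      \<open>y\<close> is therefore \<open>y e v - y e P v\<close>, an element of
      \<open>I\<close>.\<close>
    have "P (e * (y * v)) = y * e * v"
      using P_J[of "y * e * v"] mem IJ by (simp add: e_comm[of y] subset_iff flip: mult.assoc)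
    then have "t (y * v) = y * t v + y * e * v - y * e * P v"
      by (simp add: t_def Q_mult P_e algebra_simps)
    with that I mem subspace_add[OF I(1)] subspace_diff[OF I(1)] show ?thesis by (simp add: K_def)
  qed
  ultimately have K: "left_ideal (whole_alg sc) K"
    unfolding left_ideal_def by (intro iota_closed_submodule[OF left_module_R]) simp_all
  have "K = UNIV"
  proof (rule ccontr)
    assume "K \<noteq> UNIV"
    then obtain L where L: "maximal_left_ideal (whole_alg sc) L" "K \<subseteq> L"
      using exists_maximal_left_ideal[OF fd_regular_whole K] by auto
    then have subL: "subspace L" by (auto simp: maximal_left_ideal_def left_ideal_def is_submodule_def)
    have "J \<subseteq> L" using L(1) by (auto simp: J_def jacobson_radical_def)
    have "v \<in> L" for v
    proof -
      \<comment> \<open>Since \<open>t\<close> fixes its own values, \<open>v - t v\<close> is in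
        its kernel and so in \<open>K\<close>; this gives \<open>K + J = H\<close>.\<close>
      have "t (v - t v) = t v - t (t v)"
        using t_add[of "v - t v" "t v"] by (metis add_diff_cancel_right' diff_add_cancel)
      then have "t (v - t v) = 0" using t_J[OF t_mem] by simp
      then have "v - t v \<in> L" using L(2) subspace_0[OF I(1)] by (auto simp: K_def)
      then show ?thesis using subspace_add[OF subL _ subsetD[OF \<open>J \<subseteq> L\<close> t_mem], of "v - t v" v] by simp
    qed
    with L(1) show False by (auto simp: maximal_left_ideal_def)
  qed
  then have "t v \<in> I" for v by (auto simp: K_def)
  then have "v \<in> I" if "v \<in> J" for v using t_J[OF that] by metis
  then show ?thesis by (auto simp: I_def J_def)
qed

lemma jacobson_radical_eq: "jacobson_radical (whole_alg sc) = principal_ideal (whole_alg sc) (y * e)"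
  unfolding principal_ideal_y_e using jacobson_subset_y_e y_e_subset_jacobson by (rule equalityI)

section \<open>The modules \<open>P\<^sub>j\<close>\<close>

abbreviation GA :: "('k, 'a) alg" where "GA \<equiv> group_alg G sc \<iota>"

lemma group_alg_sel [simp]:
  "alg_elts GA = span (\<iota> ` carrier G)" "alg_unit GA = 1" "alg_scale GA = sc"
  by (simp_all add: group_alg_def)

lemma iota_mem_GA [simp]: "h \<in> carrier G \<Longrightarrow> \<iota> h \<in> span (\<iota> ` carrier G)"
  by (rule span_base) simp

lemma x_mem_GA [simp]: "x \<in> span (\<iota> ` carrier G)"
  unfolding x_def by (rule iota_mem_GA) simp

lemma is_algebra_GA: "is_algebra GA"
  unfolding is_algebra_def
proof (intro conjI ballI allI)
  show "vector_space (alg_scale GA)" by simp unfold_locales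
  show "module.subspace (alg_scale GA) (alg_elts GA)" by simp
  show "alg_unit GA \<in> alg_elts GA"
    using iota_mem_GA[OF one_closed] by simp
  fix a b assume "a \<in> alg_elts GA" "b \<in> alg_elts GA"
  then have a: "a \<in> span (\<iota> ` carrier G)" and b: "b \<in> span (\<iota> ` carrier G)" by simp_all
  have h: "\<iota> h * b \<in> span (\<iota> ` carrier G)" if "h \<in> carrier G" for h
    using b
  proof (induction rule: span_induct_alt)
    case (step c u v)
    then show ?case
      using that by (auto simp: distrib_left simp flip: iota_mult intro!: span_add span_scale)
  qed (simp add: span_zero)
  show "a * b \<in> alg_elts GA"
    unfolding group_alg_sel using a
  proof (induction rule: span_induct_alt)
    case (step c u v)
    then show ?case
      using h by (auto simp: distrib_right intro!: span_add span_scale)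
  qed (simp add: span_zero)
qed simp_all

lemma left_module_GA:
  assumes "left_module (whole_alg sc) M"
  shows "left_module GA M"
  using assms is_algebra_GA unfolding left_module_def by simp

lemma is_submodule_GA:
  assumes M: "left_module GA M" and N: "Modules.module.subspace (mod_scale M) N" "N \<subseteq> mod_space M"
    and iota: "\<And>h v. h \<in> carrier G \<Longrightarrow> v \<in> N \<Longrightarrow> mod_act M (\<iota> h) v \<in> N"
  shows "is_submodule GA M N"
proof -
  interpret M: left_mod GA M using M by unfold_locales
  have NM: "v \<in> mod_space M" if "v \<in> N" for v using N(2) that by auto
  have "a \<in> span (\<iota> ` carrier G) \<and> (\<forall>v\<in>N. mod_act M a v \<in> N)" if "a \<in> span (\<iota> ` carrier G)" for a
    using that
  proof (induction rule: span_induct_alt)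
    case base
    have "mod_act M 0 v = 0" if "v \<in> mod_space M" for v
      using M.act_add_left[of 0 0 v] that by (simp add: span_zero)
    then show ?case using M.subspace_0[OF N(1)] by (simp add: NM span_zero)
  next
    case (step c b a)
    then have b: "b \<in> span (\<iota> ` carrier G)" "\<And>v. v \<in> N \<Longrightarrow> mod_act M b v \<in> N"
      using iota by (auto simp: span_base)
    have "mod_act M (sc c b + a) v = mod_scale M c (mod_act M b v) + mod_act M a v" if "v \<in> N" for v
      using M.act_add_left[of "sc c b" a v] M.act_scale_left[of b v c] step b NM[OF that]
      by (simp add: span_scale)
    then show ?case
      using b step M.subspace_add[OF N(1)] M.subspace_scale[OF N(1)]
      by (simp add: span_add span_scale)
  qed
  then show ?thesis using N unfolding is_submodule_def by simp
qed

section \<open>The action of \<open>H\<close> on the sum of the \<open>x^k V\<close>\<close>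

context
  fixes V :: "('k, 'a, 'v::ab_group_add) lmod" and l :: 'k
  assumes V: "left_module GA V"
    and x_V: "\<And>v. v \<in> mod_space V \<Longrightarrow> mod_act V x v = mod_scale V l v"
begin

interpretation V: left_mod GA V using V by unfold_locales

abbreviation P :: "('k, 'a, nat \<Rightarrow> 'v) lmod" where "P \<equiv> P_mod G \<chi> n sc \<iota> y V l"
abbreviation S :: "(nat \<Rightarrow> 'v) set" where "S \<equiv> mod_space P"
abbreviation sP :: "'k \<Rightarrow> (nat \<Rightarrow> 'v) \<Rightarrow> nat \<Rightarrow> 'v" where "sP \<equiv> mod_scale P"
abbreviation Y :: "(nat \<Rightarrow> 'v) \<Rightarrow> nat \<Rightarrow> 'v" where "Y \<equiv> P_y n V l"
abbreviation T :: "'g \<Rightarrow> (nat \<Rightarrow> 'v) \<Rightarrow> nat \<Rightarrow> 'v" where "T \<equiv> P_h \<chi> \<iota> V"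

lemma mem_S: "u \<in> S \<longleftrightarrow> (\<forall>k<n. u k \<in> mod_space V) \<and> (\<forall>k\<ge>n. u k = 0)"
  by (simp add: P_mod_def)

lemma S_mem: "u \<in> S \<Longrightarrow> u k \<in> mod_space V"
  by (cases "k < n") (auto simp: mem_S)

lemma sP_apply: "sP c u k = mod_scale V c (u k)"
  by (simp add: P_mod_def)

lemma P_vs: "vector_space sP"
  by unfold_locales (auto simp: sP_apply fun_eq_iff V.scale_right_distrib V.scale_left_distrib)

interpretation P: vector_space sP by (rule P_vs)

lemma P_subspace: "P.subspace S"
  by (rule P.subspaceI) (auto simp: mem_S sP_apply)

lemma V_assoc: "h \<in> carrier G \<Longrightarrow> h' \<in> carrier G \<Longrightarrow> v \<in> mod_space V \<Longrightarrow>
    mod_act V (\<iota> h) (mod_act V (\<iota> h') v) = mod_act V (\<iota> (h \<otimes>\<^bsub>G\<^esub> h')) v"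
  by (simp add: iota_mult V.act_mult)

lemma T_apply: "T h u k = mod_scale V (inverse (\<chi> h) ^ k) (mod_act V (\<iota> h) (u k))"
  by (simp add: P_h_def)

lemma T_mem: "h \<in> carrier G \<Longrightarrow> u \<in> S \<Longrightarrow> T h u \<in> S"
  by (auto simp: mem_S T_apply)

lemma T_add: "h \<in> carrier G \<Longrightarrow> u \<in> S \<Longrightarrow> u' \<in> S \<Longrightarrow> T h (u + u') = T h u + T h u'"
  by (auto simp: fun_eq_iff T_apply V.act_add S_mem V.scale_right_distrib)

lemma T_scale: "h \<in> carrier G \<Longrightarrow> u \<in> S \<Longrightarrow> T h (sP c u) = sP c (T h u)"
  by (auto simp: fun_eq_iff T_apply V.act_scale S_mem sP_apply mult.commute)

lemma T_mult: "h \<in> carrier G \<Longrightarrow> h' \<in> carrier G \<Longrightarrow> u \<in> S \<Longrightarrow> T h (T h' u) = T (h \<otimes>\<^bsub>G\<^esub> h') u"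
  by (auto simp: fun_eq_iff T_apply V.act_scale S_mem V_assoc chi_mult power_mult_distrib mult.commute)

lemma T_one: "u \<in> S \<Longrightarrow> T \<one>\<^bsub>G\<^esub> u = u"
  using V.act_unit by (auto simp: fun_eq_iff T_apply S_mem)

lemma T_x: "u \<in> S \<Longrightarrow> T (g [^]\<^bsub>G\<^esub> n) u = sP l u"
  by (auto simp: fun_eq_iff T_apply chi_pow chi_pow_n sP_apply x_V[unfolded x_def] S_mem)

lemma Y_apply: "Y u k =
    (if k = 0 then mod_scale V (l - 1) (u (n - 1)) else if k < n then u (k - 1) else 0)"
  by (simp add: P_y_def)

lemma Y_mem: "u \<in> S \<Longrightarrow> Y u \<in> S"
  by (auto simp: mem_S P_y_def)

lemma Y_add: "Y (u + u') = Y u + Y u'"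
  by (auto simp: fun_eq_iff P_y_def V.scale_right_distrib)

lemma Y_scale: "Y (sP c u) = sP c (Y u)"
  by (auto simp: fun_eq_iff P_y_def sP_apply mult.commute)

text \<open>At \<open>k = 0\<close>, where the top summand returns to the bottom, the factor
  \<open>\<chi> h\<close> comes from \<open>inverse_chi_pow\<close>; elsewhere it just lowers the
  exponent of the twist by one.\<close>

lemma Y_T:
  assumes h: "h \<in> carrier G" and u: "u \<in> S"
  shows "Y (T h u) = sP (\<chi> h) (T h (Y u))"
proof
  fix k
  have shift: "\<chi> h * inverse (\<chi> h) ^ k = inverse (\<chi> h) ^ (k - 1)" if "0 < k"
    using that h by (cases k) simp_all
  show "Y (T h u) k = sP (\<chi> h) (T h (Y u)) k"
    using h u inverse_chi_pow[OF h] shift by (cases "k = 0") (simp_all add: P_y_def T_apply sP_apply V.act_scale S_mem mult.commute)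
qed

lemma Y_pow_mem: "u \<in> S \<Longrightarrow> (Y ^^ i) u \<in> S"
  by (induction i) (simp_all add: Y_mem)

lemma Y_pow_add: "(Y ^^ i) (u + u') = (Y ^^ i) u + (Y ^^ i) u'"
  by (induction i) (simp_all only: funpow.simps o_apply id_apply Y_add)

lemma Y_pow_scale: "(Y ^^ i) (sP c u) = sP c ((Y ^^ i) u)"
  by (induction i) (simp_all add: Y_scale)

lemma Y_pow_T:
  assumes h: "h \<in> carrier G" and u: "u \<in> S"
  shows "T h ((Y ^^ i) u) = sP (inverse (\<chi> h) ^ i) ((Y ^^ i) (T h u))"
proof (induction i)
  case (Suc i)
  have "Y (T h ((Y ^^ i) u)) = sP (\<chi> h) (T h ((Y ^^ Suc i) u))"
    using Y_T[OF h Y_pow_mem[OF u]] by simp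
  then have "T h ((Y ^^ Suc i) u) = sP (inverse (\<chi> h)) (Y (T h ((Y ^^ i) u)))"
    using h by simp
  then show ?case by (simp only: Suc Y_scale P.scale_scale) simp
qed simp

text \<open>For \<open>i \<le> n\<close> a coordinate passes from the top to the bottom at most
  once, so at most one factor \<open>l - 1\<close> appears.\<close>

lemma Y_pow_apply:
  assumes u: "u \<in> S" and i: "i \<le> n"
  shows "(Y ^^ i) u k =
    (if k < i then mod_scale V (l - 1) (u (n - i + k)) else if k < n then u (k - i) else 0)"
  using i
proof (induction i arbitrary: k)
  case 0
  then show ?case using u by (simp add: mem_S)
next
  case (Suc i)
  have "(Y ^^ Suc i) u k = Y ((Y ^^ i) u) k" by simp
  also have "\<dots> = (if k < Suc i then mod_scale V (l - 1) (u (n - Suc i + k)) else if k < n then u (k - Suc i) else 0)"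
    using Suc.prems Suc.IH[of "n - 1"] Suc.IH[of "k - 1"]
    by (subst Y_apply) (auto simp: Suc_diff_Suc)
  finally show ?case .
qed

lemma Y_pow_n: "u \<in> S \<Longrightarrow> (Y ^^ n) u = sP (l - 1) u"
  by (auto simp: fun_eq_iff Y_pow_apply sP_apply mem_S)

abbreviation \<rho> where "\<rho> \<equiv> mod_act P"
abbreviation rep where "rep \<equiv> representation (datum_monomial \<iota> y ` datum_basis G n)"

lemma rho_apply: "\<rho> a u k = (\<Sum>p\<in>datum_basis G n.
    mod_scale V (rep a (datum_monomial \<iota> y p)) ((Y ^^ fst p) (T (snd p) u) k))"
  by (simp add: P_mod_def case_prod_beta)

lemma rho_mem:
  assumes u: "u \<in> S"
  shows "\<rho> a u \<in> S"
proof -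
  have mem: "(Y ^^ fst p) (T (snd p) u) \<in> S" if "p \<in> datum_basis G n" for p
    using that u by (intro Y_pow_mem T_mem) (auto simp: datum_basis_def)
  have "\<rho> a u k = 0" if "k \<ge> n" for k
    unfolding rho_apply using mem that by (intro sum.neutral) (auto simp: mem_S)
  moreover have "\<rho> a u k \<in> mod_space V" for k
    unfolding rho_apply using mem by (intro V.sum_mem V.scale_mem) (auto intro: S_mem)
  ultimately show ?thesis by (simp add: mem_S)
qed

lemma rho_add: "u \<in> S \<Longrightarrow> u' \<in> S \<Longrightarrow> \<rho> a (u + u') = \<rho> a u + \<rho> a u'"
  by (auto simp: fun_eq_iff rho_apply T_add Y_pow_add V.scale_right_distrib datum_basis_def
      simp flip: sum.distrib intro!: sum.cong)

lemma rho_scale: "u \<in> S \<Longrightarrow> \<rho> a (sP c u) = sP c (\<rho> a u)"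
  by (auto simp: fun_eq_iff rho_apply T_scale Y_pow_scale sP_apply V.scale_sum_right datum_basis_def
      mult.commute intro!: sum.cong)

lemma rho_add_left: "\<rho> (a + b) u = \<rho> a u + \<rho> b u"
  by (auto simp: fun_eq_iff rho_apply representation_add[OF monomial_independent] monomial_span
      V.scale_left_distrib sum.distrib)

lemma rho_scale_left: "\<rho> (sc c a) u = sP c (\<rho> a u)"
  by (auto simp: fun_eq_iff rho_apply representation_scale[OF monomial_independent] monomial_span
      sP_apply V.scale_sum_right)

lemma rho_zero: "\<rho> 0 u = 0"
  using rho_scale_left[of 0 0 u] by simp

lemma rho_monomial:
  assumes "i < n" "h \<in> carrier G"
  shows "\<rho> (y ^ i * \<iota> h) u = (Y ^^ i) (T h u)"
proof
  fix k
  let ?m = "datum_monomial \<iota> y"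
  have ih: "(i, h) \<in> datum_basis G n" using assms by (simp add: datum_basis_def)
  have "rep (?m (i, h)) (?m p) = (if p = (i, h) then 1 else 0)" if "p \<in> datum_basis G n" for p
    using that ih inj_onD[OF monomial_inj, of p "(i, h)"]
    by (auto simp: representation_basis[OF monomial_independent])
  then have "\<rho> (?m (i, h)) u k =
      (\<Sum>p\<in>datum_basis G n. if p = (i, h) then (Y ^^ fst p) (T (snd p) u) k else 0)"
    unfolding rho_apply by (intro sum.cong) auto
  also have "\<dots> = (Y ^^ i) (T h u) k"
    using ih by (simp add: datum_basis_def)
  finally show "\<rho> (y ^ i * \<iota> h) u k = (Y ^^ i) (T h u) k" by (simp add: datum_monomial_def)
qed

lemma monomial_induct [case_names zero step]:
  assumes "Q 0"
    and "\<And>c i h a. i < n \<Longrightarrow> h \<in> carrier G \<Longrightarrow> Q a \<Longrightarrow> Q (sc c (y ^ i * \<iota> h) + a)"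
  shows "Q a"
proof -
  have "a \<in> span (datum_monomial \<iota> y ` datum_basis G n)" using monomial_span by simp
  then show ?thesis
    by (induction rule: span_induct_alt) (auto simp: assms(1) datum_monomial_def datum_basis_def intro: assms(2))
qed

lemma rho_one: "u \<in> S \<Longrightarrow> \<rho> 1 u = u"
  using rho_monomial[of 0 "\<one>\<^bsub>G\<^esub>" u] by (simp add: T_one)

text \<open>The action is defined by coordinates, so multiplicativity has to be proved. It is
  checked for left multiplication by a generator on basis monomials; here moving
  \<open>\<iota> h\<close> past \<open>y^i\<close> restores the normal form.\<close>

lemma rho_iota_mult:
  assumes h: "h \<in> carrier G" and u: "u \<in> S"
  shows "\<rho> (\<iota> h * a) u = T h (\<rho> a u)"
proof (induction a rule: monomial_induct)
  case zero
  have "T h 0 = sP 0 (T h 0)"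
    using T_scale[OF h P.subspace_0[OF P_subspace], of 0] by (simp only: P.scale_zero_left)
  then show ?case by (simp only: mult_zero_right rho_zero P.scale_zero_left)
next
  case (step c i h' a)
  have "\<iota> h * (y ^ i * \<iota> h') = sc (inverse (\<chi> h) ^ i) (y ^ i * \<iota> h) * \<iota> h'"
    by (simp only: iota_y_pow[OF h] flip: mult.assoc)
  also have "\<dots> = sc (inverse (\<chi> h) ^ i) (y ^ i * \<iota> (h \<otimes>\<^bsub>G\<^esub> h'))"
    using h step by (simp add: iota_mult mult.assoc)
  finally have "\<rho> (\<iota> h * (y ^ i * \<iota> h')) u = sP (inverse (\<chi> h) ^ i) ((Y ^^ i) (T h (T h' u)))"
    using h step u by (simp add: rho_scale_left rho_monomial T_mult)
  then have *: "\<rho> (\<iota> h * (y ^ i * \<iota> h')) u = T h (\<rho> (y ^ i * \<iota> h') u)"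
    using h step u by (simp add: Y_pow_T T_mem rho_monomial)
  let ?m = "y ^ i * \<iota> h'"
  have "\<rho> (\<iota> h * (sc c ?m + a)) u = sP c (\<rho> (\<iota> h * ?m) u) + \<rho> (\<iota> h * a) u"
    by (simp only: distrib_left rho_add_left rho_scale_left mult_sc)
  also have "\<dots> = T h (sP c (\<rho> ?m u)) + T h (\<rho> a u)"
    by (simp only: * step(3) T_scale[OF h rho_mem[OF u]])
  also have "\<dots> = T h (sP c (\<rho> ?m u) + \<rho> a u)"
    by (rule T_add[OF h, symmetric]) (use P.subspace_scale[OF P_subspace] rho_mem[OF u] in auto)
  finally show ?case by (simp only: rho_add_left rho_scale_left)
qed

text \<open>The critical case is \<open>y y^(n - 1)\<close>, which is no basis monomial: its
  rewriting as \<open>x - 1\<close> matches the rule that \<open>Y ^^ n\<close> is multiplication by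
  \<open>l - 1\<close>.\<close>

lemma rho_y_mult:
  assumes u: "u \<in> S"
  shows "\<rho> (y * a) u = Y (\<rho> a u)"
proof (induction a rule: monomial_induct)
  case zero
  have "Y 0 = sP 0 (Y 0)" using Y_scale[of 0 0] by (simp only: P.scale_zero_left)
  then show ?case by (simp only: mult_zero_right rho_zero P.scale_zero_left)
next
  case (step c i h a)
  have "\<rho> (y * (y ^ i * \<iota> h)) u = Y (\<rho> (y ^ i * \<iota> h) u)"
  proof (cases "Suc i < n")
    case True
    then show ?thesis using rho_monomial[of "Suc i" h u] rho_monomial[of i h u] step by (simp add: mult.assoc)
  next
    case False
    then have n: "Suc i = n" using step by simp
    have "y * (y ^ i * \<iota> h) = y ^ n * \<iota> h" by (simp add: mult.assoc flip: n)
    \<comment> \<open>The factors \<open>y ^ 0\<close> give both terms the shape of basis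
      monomials.\<close>
    also have "\<dots> = y ^ 0 * \<iota> (g [^]\<^bsub>G\<^esub> n \<otimes>\<^bsub>G\<^esub> h) + sc (- 1) (y ^ 0 * \<iota> h)"
      using step by (simp add: y_pow_n x_def iota_mult algebra_simps)
    finally have "\<rho> (y * (y ^ i * \<iota> h)) u = T (g [^]\<^bsub>G\<^esub> n \<otimes>\<^bsub>G\<^esub> h) u + sP (- 1) (T h u)"
      using step by (simp only: rho_add_left rho_scale_left rho_monomial n_pos m_closed nat_pow_closed g_in) simp
    also have "T (g [^]\<^bsub>G\<^esub> n \<otimes>\<^bsub>G\<^esub> h) u = sP l (T h u)"
      using step u by (simp add: T_x T_mem flip: T_mult)
    also have "sP l (T h u) + sP (- 1) (T h u) = (Y ^^ n) (T h u)"
      using step u by (simp add: Y_pow_n T_mem P.scale_left_diff_distrib)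
    also have "\<dots> = Y ((Y ^^ i) (T h u))"
      using arg_cong[OF n, of "\<lambda>m. (Y ^^ m) (T h u)"] by simp
    finally show ?thesis using step(1,2) by (simp only: rho_monomial)
  qed
  then show ?case
    using step by (simp only: distrib_left rho_add_left rho_scale_left Y_add Y_scale mult_sc)
qed

lemma rho_iota: "h \<in> carrier G \<Longrightarrow> u \<in> S \<Longrightarrow> \<rho> (\<iota> h) u = T h u"
  using rho_iota_mult[of h u 1] by (simp add: rho_one)

lemma rho_y: "u \<in> S \<Longrightarrow> \<rho> y u = Y u"
  using rho_y_mult[of u 1] by (simp add: rho_one)

text \<open>Induction on the left factor with the right factor arbitrary reduces everything to the
  two product rules for generators.\<close>

lemma rho_mult: "u \<in> S \<Longrightarrow> \<rho> (a * b) u = \<rho> a (\<rho> b u)"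
proof (induction a arbitrary: b u rule: generator_induct)
  case (mult a a')
  then show ?case by (simp add: mult.assoc rho_mem)
qed (simp_all add: rho_iota_mult rho_iota rho_y_mult rho_y rho_mem distrib_right rho_add_left rho_scale_left)

lemma left_module_P: "left_module (whole_alg sc) P"
  unfolding left_module_def
  by (simp add: is_algebra_whole P_vs P_subspace rho_mem rho_add rho_scale rho_add_left rho_scale_left
      rho_mult rho_one)

text \<open>\<open>x\<close> acts as \<open>l\<close>, and \<open>x e = e\<close>, so
  \<open>l - 1\<close> annihilates every value of \<open>e\<close>.\<close>

lemma rho_e:
  assumes l: "l \<noteq> 1" and u: "u \<in> S"
  shows "\<rho> e u = 0"
proof -
  have "sP l (\<rho> e u) = \<rho> (x * e) u"
    using u by (simp only: rho_mult x_def rho_iota nat_pow_closed g_in rho_mem T_x)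
  then have "sP (l - 1) (\<rho> e u) = 0" by (simp only: x_e P.scale_left_diff_distrib) simp
  with l show ?thesis by simp
qed

lemma left_module_P_corner:
  assumes "l \<noteq> 1"
  shows "left_module H\<^sub>1 P"
proof (rule left_module_corner[OF left_module_P])
  fix u assume u: "u \<in> S"
  have "u = \<rho> (1 - e + e) u" using u by (simp add: rho_one)
  also have "\<dots> = \<rho> (1 - e) u + \<rho> e u" by (rule rho_add_left)
  finally show "\<rho> (1 - e) u = u" using rho_e[OF assms u] by simp
qed

section \<open>The summands \<open>x^k V\<close> and the simplicity of \<open>P\<close>\<close>

definition single :: "nat \<Rightarrow> 'v \<Rightarrow> nat \<Rightarrow> 'v" where "single k v = (\<lambda>j. if j = k then v else 0)"

lemma single_mem: "k < n \<Longrightarrow> v \<in> mod_space V \<Longrightarrow> single k v \<in> S"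
  by (auto simp: mem_S single_def)

lemma single_add: "single k (v + v') = single k v + single k v'"
  by (auto simp: single_def fun_eq_iff)

lemma single_scale: "single k (mod_scale V c v) = sP c (single k v)"
  by (auto simp: single_def fun_eq_iff sP_apply)

lemma single_zero: "single k 0 = 0"
  by (auto simp: single_def fun_eq_iff)

lemma sum_fun_apply: "(\<Sum>i\<in>A. f i) j = (\<Sum>i\<in>A. f i j)" for f :: "'x \<Rightarrow> nat \<Rightarrow> 'v"
  by (induction A rule: infinite_finite_induct) auto

lemma sum_single:
  assumes "u \<in> S"
  shows "(\<Sum>k<n. single k (u k)) = u"
proof
  fix j
  have "(\<Sum>k<n. single k (u k)) j = (\<Sum>k<n. if k = j then u j else 0)"
    unfolding sum_fun_apply single_def by (intro sum.cong) auto
  also have "\<dots> = u j" using assms by (simp add: mem_S)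
  finally show "(\<Sum>k<n. single k (u k)) j = u j" .
qed

lemma T_single: "h \<in> carrier G \<Longrightarrow>
    T h (single k v) = single k (mod_scale V (inverse (\<chi> h) ^ k) (mod_act V (\<iota> h) v))"
  by (auto simp: fun_eq_iff T_apply single_def)

lemma Y_pow_single_0: "k < n \<Longrightarrow> v \<in> mod_space V \<Longrightarrow> (Y ^^ k) (single 0 v) = single k v"
  by (auto simp: fun_eq_iff Y_pow_apply single_mem) (auto simp: single_def)

lemma Y_pow_single: "0 < k \<Longrightarrow> k < n \<Longrightarrow> v \<in> mod_space V \<Longrightarrow>
    (Y ^^ (n - k)) (single k v) = single 0 (mod_scale V (l - 1) v)"
  by (auto simp: fun_eq_iff Y_pow_apply single_mem) (auto simp: single_def)

lemma fd_P:
  assumes fd: "fd_module GA V" and l: "l \<noteq> 1"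
  shows "fd_module H\<^sub>1 P"
proof -
  obtain B where B: "finite B" "V.span B = mod_space V" using fd by (auto simp: fd_module_def)
  let ?B = "\<Union>k<n. single k ` B"
  have "P.span ?B = S"
  proof
    have "?B \<subseteq> S" using B V.span_base[of _ B] by (auto intro: single_mem)
    then show "P.span ?B \<subseteq> S" by (rule P.span_minimal[OF _ P_subspace])
    have single: "single k v \<in> P.span ?B" if k: "k < n" and v: "v \<in> V.span B" for k v
      using v
    proof (induction rule: V.span_induct_alt)
      case base
      show ?case unfolding single_zero by (rule P.span_zero)
    next
      case (step c b v)
      show ?case unfolding single_add single_scale
        using step k by (intro P.span_add P.span_scale) (auto intro: P.span_base)
    qed
    show "S \<subseteq> P.span ?B"
    proof
      fix u assume u: "u \<in> S"
      have "(\<Sum>k<n. single k (u k)) \<in> P.span ?B"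
        using S_mem[OF u] B(2) by (intro P.span_sum single) auto
      then show "u \<in> P.span ?B" by (simp only: sum_single[OF u])
    qed
  qed
  with B(1) left_module_P_corner[OF l] show ?thesis unfolding fd_module_def
    by (intro conjI exI[of _ ?B]) auto
qed

text \<open>Schur's lemma for the central element \<open>g\<close>; its eigenvectors are found with the
  projections \<open>1/n \<Sum>\<^sub>m d\<^sup>-\<^sup>m g\<^sup>m\<close>, where \<open>d\<close> ranges over the \<open>n\<close>-th roots of \<open>l\<close>.\<close>

lemma g_scalar:
  assumes simple: "simple_module GA V" and \<mu>: "\<mu> ^ n = l" and l0: "l \<noteq> 0"
  shows "\<exists>c. c \<noteq> 0 \<and> (\<forall>v\<in>mod_space V. mod_act V (\<iota> g) v = mod_scale V c v)"
proof -
  obtain v0 where v0: "v0 \<in> mod_space V" "v0 \<noteq> 0"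
    using simple V.zero_mem unfolding simple_module_def by blast
  have mu0: "\<mu> \<noteq> 0" using \<mu> l0 n_ge by (auto simp: power_0_left)
  define q where "q = \<chi> g"
  have q0: "q \<noteq> 0" and qn: "q ^ n = 1" by (simp_all add: q_def chi_pow_n)
  \<comment> \<open>As \<open>q\<close> is a primitive n-th root of unity, these are all n-th roots
    of \<open>l\<close>, the candidates for the eigenvalue of \<open>g\<close>.\<close>
  define d where "d i = \<mu> * q ^ i" for i
  have d0: "d i \<noteq> 0" for i using mu0 q0 by (simp add: d_def)
  have dn: "d i ^ n = l" for i
    by (simp add: d_def power_mult_distrib \<mu> qn power_mult[symmetric] mult.commute[of i]) (simp add: power_mult qn)
  define t where "t m = mod_act V (\<iota> (g [^]\<^bsub>G\<^esub> (m::nat))) v0" for m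
  have t_mem: "t m \<in> mod_space V" for m using v0 by (simp add: t_def)
  have t_Suc: "mod_act V (\<iota> g) (t m) = t (Suc m)" for m
    using v0 by (simp add: t_def V_assoc g_comm[of "g [^]\<^bsub>G\<^esub> m"])
  have t_0: "t 0 = v0" using V.act_unit v0 by (simp add: t_def)
  have t_n: "t n = mod_scale V l v0" using v0 by (simp add: t_def x_V[unfolded x_def])
  define w' where "w' i = (\<Sum>m<n. mod_scale V (inverse (d i) ^ m) (t m))" for i
  have w'_mem: "w' i \<in> mod_space V" for i
    unfolding w'_def by (intro V.sum_mem V.scale_mem t_mem)
  have eig: "mod_act V (\<iota> g) (w' i) = mod_scale V (d i) (w' i)" for i
  proof -
    let ?f = "\<lambda>m. mod_scale V (d i * inverse (d i) ^ m) (t m)"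
    have "mod_act V (\<iota> g) (w' i) = (\<Sum>m<n. mod_scale V (inverse (d i) ^ m) (t (Suc m)))"
      using t_mem by (simp add: w'_def V.act_sum V.act_scale t_Suc)
    also have "\<dots> = (\<Sum>m<n. ?f (Suc m))"
      using d0[of i] by (intro sum.cong) simp_all
    also have "\<dots> = (\<Sum>m<n. ?f m)"
    proof -
      \<comment> \<open>\<open>d i ^ n = l\<close> cancels the scalar by which \<open>g^n\<close>
        acts, so the shifted sum closes up.\<close>
      have "?f n = ?f 0"
        using d0[of i] l0 by (simp add: t_n t_0 power_inverse dn del: power_inverse flip: power_inverse)
           (simp add: power_inverse dn)
      moreover have "?f 0 + (\<Sum>m<n. ?f (Suc m)) = (\<Sum>m<n. ?f m) + ?f n"
        using sum.lessThan_Suc_shift[of ?f n] unfolding sum.lessThan_Suc by (rule sym)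
      ultimately show ?thesis by simp
    qed
    also have "\<dots> = mod_scale V (d i) (w' i)" by (simp add: w'_def V.scale_sum_right)
    finally show ?thesis .
  qed
  \<comment> \<open>The unnormalised projections of \<open>v0\<close> add up to \<open>n\<close>
    times \<open>v0\<close>, so at least one of them is nonzero.\<close>
  have "(\<Sum>i<n. w' i) = (\<Sum>m<n. \<Sum>i<n. mod_scale V (inverse (d i) ^ m) (t m))"
    unfolding w'_def by (rule sum.swap)
  also have "\<dots> = (\<Sum>m<n. if m = 0 then mod_scale V (of_nat n) v0 else 0)"
  proof (intro sum.cong refl)
    fix m assume m: "m \<in> {..<n}"
    have "(\<Sum>i<n. mod_scale V (inverse (d i) ^ m) (t m)) = mod_scale V (\<Sum>i<n. inverse (d i) ^ m) (t m)"
      by (simp add: V.scale_sum_left)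
    moreover have "(\<Sum>i<n. inverse (d i) ^ m) = 0" if "m \<noteq> 0"
    proof -
      define \<xi> where "\<xi> = inverse q ^ m"
      have "(\<Sum>i<n. inverse (d i) ^ m) = inverse \<mu> ^ m * (\<Sum>i<n. \<xi> ^ i)"
        unfolding sum_distrib_left
        by (intro sum.cong) (simp_all add: d_def \<xi>_def power_mult_distrib power_inverse power_mult[symmetric] mult.commute)
      \<comment> \<open>\<open>q\<close> has order exactly \<open>n\<close> and
        \<open>0 < m < n\<close>; a geometric sum over a nontrivial n-th root of unity
        vanishes.\<close>
      moreover have "\<xi> \<noteq> 1"
        using chi_g_primitive[of m] m that by (auto simp: \<xi>_def q_def power_inverse inverse_eq_1_iff)
      moreover have "\<xi> ^ n = 1"
        using qn by (simp add: \<xi>_def power_inverse power_mult[symmetric] mult.commute[of m]) (simp add: power_mult)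
      ultimately show ?thesis
        using one_diff_power_eq[of \<xi> n] by simp
    qed
    ultimately show "(\<Sum>i<n. mod_scale V (inverse (d i) ^ m) (t m)) =
        (if m = 0 then mod_scale V (of_nat n) v0 else 0)"
      by (simp add: t_0)
  qed
  also have "\<dots> = mod_scale V (of_nat n) v0" by (simp add: sum.delta)
  finally have "(\<Sum>i<n. w' i) \<noteq> 0" using v0 n_ge by simp
  then obtain i where i: "w' i \<noteq> 0" by (meson sum.not_neutral_contains_not_neutral)
  \<comment> \<open>An eigenspace of a central element is a submodule, hence all of the simple
    \<open>V\<close> once it is nonzero.\<close>
  let ?E = "{v \<in> mod_space V. mod_act V (\<iota> g) v = mod_scale V (d i) v}"
  have "is_submodule GA V ?E"
  proof (rule is_submodule_GA[OF V])
    show "V.subspace ?E"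
      by (rule V.subspaceI) (auto simp: V.act_add V.scale_right_distrib V.act_scale mult.commute)
    fix h v assume h: "h \<in> carrier G" and v: "v \<in> ?E"
    then have "mod_act V (\<iota> g) (mod_act V (\<iota> h) v) = mod_act V (\<iota> h) (mod_act V (\<iota> g) v)"
      using V_assoc[of g h v] V_assoc[of h g v] g_comm[of h] by simp
    with h v show "mod_act V (\<iota> h) v \<in> ?E" by (simp add: V.act_scale)
  qed auto
  moreover have "w' i \<in> ?E" using w'_mem eig by simp
  ultimately have "?E = mod_space V" using i simple unfolding simple_module_def by blast
  with d0[of i] show ?thesis by blast
qed

text \<open>A nonzero element of smallest support in a submodule is concentrated in one summand,
  since otherwise \<open>g\<close> minus one of its eigenvalues shortens it. Powers of
  \<open>y\<close> bring it to degree 0, where simplicity of \<open>V\<close> applies, and from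
  there to every degree.\<close>

lemma simple_P:
  assumes simple: "simple_module GA V" and \<mu>: "\<mu> ^ n = l" and l0: "l \<noteq> 0" and l1: "l \<noteq> 1"
  shows "simple_module H\<^sub>1 P"
  unfolding simple_module_def
proof (intro conjI allI impI left_module_P_corner[OF l1])
  obtain v0 where v0: "v0 \<in> mod_space V" "v0 \<noteq> 0"
    using simple V.zero_mem unfolding simple_module_def by blast
  have "single 0 v0 \<in> S" "single 0 v0 0 \<noteq> (0 :: nat \<Rightarrow> 'v) 0"
    using v0 by (auto intro: single_mem) (simp add: single_def)
  then show "S \<noteq> {0}" by (metis singletonD)
  fix N assume N1: "is_submodule H\<^sub>1 P N"
  interpret C: left_mod "H\<^sub>1" P using left_module_P_corner[OF l1] by unfold_locales
  note N = submoduleD[OF N1]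
  have NS: "u \<in> S" if "u \<in> N" for u using N(2) that by auto
  \<comment> \<open>\<open>N\<close> is given as stable under the corner; since \<open>1 - e\<close>
    acts as the identity on \<open>P\<close>, it is stable under all of \<open>H\<close>.\<close>
  have N_act: "\<rho> a u \<in> N" if "u \<in> N" for a u
  proof -
    have "\<rho> a u = \<rho> (a * (1 - e)) u"
      using rho_mult[OF NS[OF that], of a "1 - e"] C.act_unit[of u] NS[OF that] by simp
    then show ?thesis using N(3)[OF _ that, of "a * (1 - e)"] by simp
  qed
  have N_Y: "(Y ^^ i) u \<in> N" if "u \<in> N" for i u
  proof (induction i)
    case (Suc i)
    then show ?case using N_act[OF Suc, of y] by (simp add: rho_y NS)
  qed (use that in simp)
  obtain c where c: "c \<noteq> 0" "\<And>v. v \<in> mod_space V \<Longrightarrow> mod_act V (\<iota> g) v = mod_scale V c v"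
    using g_scalar[OF simple \<mu> l0] by blast
  define q where "q = inverse (\<chi> g)"
  have g_act: "\<rho> (\<iota> g) u k = mod_scale V (q ^ k * c) (u k)" if "u \<in> S" for u k
    using that by (simp add: rho_iota T_apply c S_mem q_def)
  have q_inj: "q ^ j \<noteq> q ^ k" if "j < n" "k < n" "j \<noteq> k" for j k
  proof -
    have *: "q ^ j \<noteq> q ^ k" if "j < k" "k < n" for j k
    proof
      assume "q ^ j = q ^ k"
      then have "\<chi> g ^ j = \<chi> g ^ k" by (simp add: q_def power_inverse)
      also have "\<dots> = \<chi> g ^ j * \<chi> g ^ (k - j)" using that by (simp flip: power_add)
      finally have "\<chi> g ^ (k - j) = 1" by simp
      then show False using chi_g_primitive[of "k - j"] that by simp
    qed
    show ?thesis using *[of j k] *[of k j] that by (cases "j < k") auto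
  qed
  show "N = {0} \<or> N = S"
  proof (cases "N \<subseteq> {0}")
    case True
    then show ?thesis using P.subspace_0[OF N(1)] by blast
  next
    case False
    define supp where "supp u = {k. u k \<noteq> 0}" for u :: "nat \<Rightarrow> 'v"
    have supp_n: "supp u \<subseteq> {..<n}" if "u \<in> N" for u
    proof
      fix j assume "j \<in> supp u"
      then show "j \<in> {..<n}" using NS[OF that] by (cases "j < n") (auto simp: supp_def mem_S)
    qed
    have fin: "finite (supp u)" if "u \<in> N" for u
      using finite_subset[OF supp_n[OF that]] by simp
    obtain u1 where "u1 \<in> N \<and> u1 \<noteq> 0" using False by blast
    then obtain u where u: "u \<in> N" "u \<noteq> 0"
      and min: "\<And>u'. u' \<in> N \<Longrightarrow> u' \<noteq> 0 \<Longrightarrow> card (supp u) \<le> card (supp u')"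
      using ex_has_least_nat[of "\<lambda>u. u \<in> N \<and> u \<noteq> 0" u1 "\<lambda>u. card (supp u)"] by blast
    obtain k where k: "u k \<noteq> 0" using u(2) by (auto simp: fun_eq_iff)
    then have kn: "k < n" using supp_n[OF u(1)] by (auto simp: supp_def)
    have only_k: "u j = 0" if "j \<noteq> k" for j
    proof (rule ccontr)
      assume j: "u j \<noteq> 0"
      then have jn: "j < n" using supp_n[OF u(1)] by (auto simp: supp_def)
      \<comment> \<open>Kills coordinate \<open>j\<close> and multiplies coordinate \<open>k\<close>
        by \<open>q^k c - q^j c\<close>, which is nonzero.\<close>
      define u' where "u' = \<rho> (\<iota> g) u - sP (q ^ j * c) u"
      have u'N: "u' \<in> N"
        unfolding u'_def by (intro P.subspace_diff[OF N(1)] P.subspace_scale[OF N(1)] N_act u(1))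
      have u': "u' i = mod_scale V (q ^ i * c - q ^ j * c) (u i)" for i
        by (simp add: u'_def fun_diff_def g_act NS[OF u(1)] sP_apply V.scale_left_diff_distrib)
      have "u' k \<noteq> 0" using k q_inj[OF kn jn] that c(1) by (auto simp: u' simp flip: left_diff_distrib)
      then have "u' \<noteq> 0" by auto
      then have "card (supp u) \<le> card (supp u')" by (rule min[OF u'N])
      moreover have "supp u' \<subseteq> supp u" by (auto simp: supp_def u')
      moreover have "j \<in> supp u" "j \<notin> supp u'" using j by (simp_all add: supp_def u')
      ultimately show False
        using psubset_card_mono[OF fin[OF u(1)], of "supp u'"] by (auto simp: psubset_eq)
    qed
    have uk: "u = single k (u k)" using only_k by (auto simp: single_def fun_eq_iff)
    have ukV: "u k \<in> mod_space V" by (rule S_mem[OF NS[OF u(1)]])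
    \<comment> \<open>The degree 0 part of \<open>N\<close>, seen inside \<open>V\<close>. The twist
      by \<open>\<chi>\<close> is trivial there, so it is stable under the group algebra.\<close>
    define W where "W = {v \<in> mod_space V. single 0 v \<in> N}"
    have "\<exists>v\<in>W. v \<noteq> 0"
    proof (cases "k = 0")
      case True
      then show ?thesis using uk u(1) ukV k by (auto simp: W_def)
    next
      case False
      have "single 0 (mod_scale V (l - 1) (u k)) = (Y ^^ (n - k)) u"
        using False kn ukV uk by (metis Y_pow_single gr0I)
      then have "single 0 (mod_scale V (l - 1) (u k)) \<in> N" using N_Y[OF u(1)] by simp
      then show ?thesis using ukV k l1 by (intro bexI[of _ "mod_scale V (l - 1) (u k)"]) (auto simp: W_def)
    qed
    moreover have "is_submodule GA V W"
    proof (rule is_submodule_GA[OF V])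
      show "V.subspace W"
        by (rule V.subspaceI)
          (auto simp only: W_def mem_Collect_eq single_zero single_add single_scale V.zero_mem V.add_mem V.scale_mem
            intro: P.subspace_0[OF N(1)] P.subspace_add[OF N(1)] P.subspace_scale[OF N(1)])
      show "W \<subseteq> mod_space V" by (auto simp: W_def)
      fix h v assume h: "h \<in> carrier G" and v: "v \<in> W"
      have "\<rho> (\<iota> h) (single 0 v) = single 0 (mod_act V (\<iota> h) v)"
        using h v by (simp add: rho_iota single_mem W_def T_single)
      with h v N_act[of "single 0 v" "\<iota> h"] show "mod_act V (\<iota> h) v \<in> W" by (simp add: W_def)
    qed
    ultimately have W: "W = mod_space V" using simple unfolding simple_module_def by blast
    have "u \<in> N" if u: "u \<in> S" for u
    proof -
      have "single k (u k) \<in> N" if "k < n" for k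
        using N_Y[of "single 0 (u k)" k] S_mem[OF u, of k] W Y_pow_single_0[OF that, of "u k"]
        by (auto simp: W_def)
      then have "(\<Sum>k<n. single k (u k)) \<in> N" by (intro P.subspace_sum[OF N(1)]) auto
      then show ?thesis by (simp only: sum_single[OF u])
    qed
    with N(2) show ?thesis by blast
  qed
qed

text \<open>The universal property of induction: \<open>x^k v\<close> must go to
  \<open>y^k \<phi>(v)\<close>. For \<open>y\<close> on the top summand, the scalar
  \<open>l - 1\<close> on \<open>V\<close> is the action of \<open>x - 1\<close>, which
  \<open>\<phi>\<close> carries to the action of \<open>y^n\<close> on \<open>N\<close>.\<close>

lemma P_extend:
  assumes N: "left_module (whole_alg sc) N" and \<phi>: "mod_hom GA V N \<phi>"
  shows "mod_hom (whole_alg sc) P N (\<lambda>u. \<Sum>k<n. mod_act N (y ^ k) (\<phi> (u k)))"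
proof -
  interpret N: left_mod "whole_alg sc" N using N by unfold_locales
  let ?F = "\<lambda>u. \<Sum>k<n. mod_act N (y ^ k) (\<phi> (u k))"
  have lin: "linear_on V N \<phi>" using \<phi> by (simp add: mod_hom_iff)
  have \<phi>_iota: "\<phi> (mod_act V (\<iota> h) v) = mod_act N (\<iota> h) (\<phi> v)" if "h \<in> carrier G" "v \<in> mod_space V" for h v
    using \<phi> that by (simp add: mod_hom_iff)
  note mem = S_mem linear_onD(1)[OF lin]
  show ?thesis
  proof (rule mod_hom_if_generators[OF left_module_P N])
    show "linear_on P N ?F"
      unfolding linear_on_def
      by (auto simp: mem linear_onD[OF lin] N.act_add N.act_scale sP_apply sum.distrib N.scale_sum_right
          intro!: N.sum_mem)
    fix u assume u: "u \<in> S"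
    show "?F (\<rho> (\<iota> h) u) = mod_act N (\<iota> h) (?F u)" if h: "h \<in> carrier G" for h
    proof -
      have "mod_act N (y ^ k) (\<phi> (\<rho> (\<iota> h) u k)) = mod_act N (\<iota> h) (mod_act N (y ^ k) (\<phi> (u k)))" for k
      proof -
        have "mod_act N (y ^ k) (\<phi> (\<rho> (\<iota> h) u k)) =
            mod_scale N (inverse (\<chi> h) ^ k) (mod_act N (y ^ k * \<iota> h) (\<phi> (u k)))"
          using u h by (simp add: rho_iota T_apply linear_onD[OF lin] mem \<phi>_iota N.act_scale N.act_mult)
        also have "\<dots> = mod_act N (\<iota> h * y ^ k) (\<phi> (u k))"
          using u h N.act_scale_left[of "y ^ k * \<iota> h" "\<phi> (u k)"] by (simp add: iota_y_pow mem)
        finally show ?thesis using u by (simp add: N.act_mult mem)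
      qed
      then show ?thesis using u by (simp add: N.act_sum mem)
    qed
    obtain n' where n': "n' = n - 1" by simp
    have Sn: "Suc n' = n" by (simp add: n')
    let ?t = "\<lambda>k. mod_act N (y ^ k) (\<phi> (Y u k))"
    have Suc: "?t (Suc k) = mod_act N y (mod_act N (y ^ k) (\<phi> (u k)))" if "k < n'" for k
    proof -
      have "Suc k < n" using that Sn by simp
      then show ?thesis using u by (simp add: Y_apply N.act_mult mem)
    qed
    have "?t 0 = mod_act N 1 (\<phi> (mod_scale V (l - 1) (u n')))"
      by (simp add: Y_apply n')
    also have "\<dots> = \<phi> (mod_scale V (l - 1) (u n'))"
      using N.act_unit u by (simp add: mem)
    also have "mod_scale V (l - 1) (u n') = mod_act V x (u n') - u n'"
      using u by (simp add: x_V mem V.scale_left_diff_distrib)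
    also have "\<phi> \<dots> = mod_act N x (\<phi> (u n')) - \<phi> (u n')"
      using u \<phi> by (simp add: linear_on_diff[OF V lin] mem mod_hom_iff)
    also have "\<dots> = mod_act N (x - 1) (\<phi> (u n'))"
      using N.act_add_left[of "x - 1" 1 "\<phi> (u n')"] N.act_unit[of "\<phi> (u n')"] u by (simp add: mem)
    also have "x - 1 = y * y ^ n'" using y_pow_n Sn power_Suc[of y n'] by simp
    also have "mod_act N (y * y ^ n') (\<phi> (u n')) = mod_act N y (mod_act N (y ^ n') (\<phi> (u n')))"
      using u by (simp add: N.act_mult mem)
    finally have "(\<Sum>k<Suc n'. ?t k) = (\<Sum>k<Suc n'. mod_act N y (mod_act N (y ^ k) (\<phi> (u k))))"
      unfolding sum.lessThan_Suc_shift[of ?t] using Suc by (simp add: add.commute)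
    then have "?F (Y u) = mod_act N y (?F u)"
      using u by (simp add: N.act_sum mem Sn del: sum.lessThan_Suc)
    then show "?F (\<rho> y u) = mod_act N y (?F u)" using u by (simp add: rho_y)
  qed
qed

end

text \<open>In contrast to \<open>mod_hom_inflate\<close>, only the target is inflated:
  \<open>P\<close> is an \<open>H\<close>-module from the start.\<close>

lemma mod_hom_corner: "mod_hom (whole_alg sc) N (inflate M) f \<Longrightarrow> mod_hom H\<^sub>1 N M f"
  by (auto simp: mod_hom_def mult.assoc)

lemma simple_corner_module_iso_P:
  fixes M :: "('k, 'a, 'm::ab_group_add) lmod" and V :: "'i \<Rightarrow> ('k, 'a, 'v::ab_group_add) lmod"
  assumes M: "simple_module H\<^sub>1 M" and fd: "fd_module H\<^sub>1 M"
    and simples: "complete_set_of_simples GA \<Omega> V"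
    and x_V: "\<And>i v. i \<in> \<Omega> \<Longrightarrow> v \<in> mod_space (V i) \<Longrightarrow> mod_act (V i) x v = mod_scale (V i) (lam i) v"
    and lam: "\<And>i. i \<in> \<Omega> \<Longrightarrow> lam i \<noteq> 0 \<and> (\<exists>\<mu>. \<mu> ^ n = lam i)"
  shows "\<exists>j\<in>\<Omega>. lam j \<noteq> 1 \<and> mod_iso H\<^sub>1 M (P_mod G \<chi> n sc \<iota> y (V j) (lam j))"
proof -
  let ?M = "inflate M"
  have lM: "left_module H\<^sub>1 M" using M by (simp add: simple_module_def)
  interpret M1: left_mod "H\<^sub>1" M using lM by unfold_locales
  have lH: "left_module (whole_alg sc) ?M" by (rule left_module_inflate[OF lM])
  interpret M: left_mod "whole_alg sc" ?M using lH by unfold_locales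
  have lG: "left_module GA ?M" by (rule left_module_GA[OF lH])
  have fdG: "fd_module GA ?M" using fd lG by (simp add: fd_module_def)
  have "mod_space ?M \<noteq> {0}" using M by (simp add: simple_module_def)
  from exists_simple_submodule[OF fdG is_submodule_space[OF lG] this]
  obtain S where S: "is_submodule GA ?M S" "simple_module GA (?M\<lparr>mod_space := S\<rparr>)" by blast
  let ?S = "?M\<lparr>mod_space := S\<rparr>"
  have lS: "left_module GA ?S" by (rule left_module_submodule[OF lG S(1)])
  obtain W :: "('k, 'a, nat \<Rightarrow> 'k) lmod" and f where W: "fd_module GA W" "mod_hom GA ?S W f"
      "bij_betw f (mod_space ?S) (mod_space W)"
    using fd_module_coordinates[OF fd_module_submodule[OF fdG S(1)]] by blast
  have lW: "left_module GA W" using W(1) by (simp add: fd_module_def)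
  have "simple_module GA W" by (rule simple_transport[OF S(2) lW W(2,3)])
  then obtain j where j: "j \<in> \<Omega>" "mod_iso GA W (V j)"
    using simples W(1) unfolding complete_set_of_simples_def by blast
  have Vj: "simple_module GA (V j)" and lV: "left_module GA (V j)"
    using simples j(1) by (auto simp: complete_set_of_simples_def simple_module_def)
  interpret V: left_mod GA "V j" using lV by unfold_locales
  obtain f' where f': "mod_hom GA (V j) W f'" "bij_betw f' (mod_space (V j)) (mod_space W)"
    using mod_iso_sym[OF lW j(2)] by (auto simp: mod_iso_def)
  \<comment> \<open>Embeds \<open>V j\<close> into \<open>M\<close> by way of the coordinate copy
    \<open>W\<close> of the simple submodule \<open>S\<close>.\<close>
  define \<phi> where "\<phi> = (\<lambda>v. the_inv_into (mod_space ?S) f (f' v))"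
  have \<phi>S: "mod_hom GA (V j) ?S \<phi>"
    unfolding \<phi>_def by (rule mod_hom_comp[OF f'(1) mod_hom_the_inv_into[OF lS W(2,3)]])
  have \<phi>: "mod_hom GA (V j) ?M \<phi>"
    using \<phi>S submoduleD(2)[OF S(1)] by (auto simp: mod_hom_def)
  have lin: "linear_on (V j) ?S \<phi>" using \<phi>S by (simp add: mod_hom_iff)
  have "bij_betw (the_inv_into (mod_space ?S) f \<circ> f') (mod_space (V j)) (mod_space ?S)"
    by (rule bij_betw_trans[OF f'(2) bij_betw_the_inv_into[OF W(3)]])
  then have inj: "inj_on \<phi> (mod_space (V j))"
    by (simp add: bij_betw_def \<phi>_def comp_def)
  obtain v where v: "v \<in> mod_space (V j)" "v \<noteq> 0"
    using Vj V.zero_mem unfolding simple_module_def by blast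
  have \<phi>v: "\<phi> v \<noteq> 0"
    using inj_onD[OF inj, of v 0] v linear_on_zero[OF lV lin] by auto
  have \<phi>vM: "\<phi> v \<in> mod_space M" using \<phi> v by (simp add: mod_hom_def)
  note x_Vj = x_V[OF j(1)]
  \<comment> \<open>If \<open>x\<close> fixed \<open>\<phi> v\<close>, then
    \<open>1 - e = w (x - 1)\<close> would kill it, but \<open>1 - e\<close> acts as the identity on
    \<open>M\<close>.\<close>
  have lam1: "lam j \<noteq> 1"
  proof
    assume "lam j = 1"
    then have "mod_act ?M x (\<phi> v) = \<phi> v"
      using \<phi> v x_Vj[OF v(1)] by (metis V.scale_one group_alg_sel(1) mod_hom_def x_mem_GA)
    then have "mod_act ?M (x - 1) (\<phi> v) = 0"
      using M.act_add_left[of "x - 1" 1 "\<phi> v"] M.act_unit[of "\<phi> v"] \<phi>vM by simp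
    moreover have "1 - e = w * (x - 1)" by (simp only: w_comm w_inverse)
    ultimately have "mod_act ?M (1 - e) (\<phi> v) = 0"
      using M.act_mult[of w "x - 1" "\<phi> v"] \<phi>vM M.act_zero[of w] by (simp del: inflate_sel(3))
    moreover have "mod_act ?M (1 - e) (\<phi> v) = \<phi> v"
      using M1.act_unit[OF \<phi>vM] by simp
    ultimately show False using \<phi>v by simp
  qed
  let ?P = "P_mod G \<chi> n sc \<iota> y (V j) (lam j)"
  let ?F = "\<lambda>u. \<Sum>k<n. mod_act ?M (y ^ k) (\<phi> (u k))"
  obtain \<mu> where \<mu>: "\<mu> ^ n = lam j" using lam[OF j(1)] by blast
  have lam0: "lam j \<noteq> 0" using lam[OF j(1)] by (rule conjunct1)
  have P: "simple_module H\<^sub>1 ?P"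
    by (rule simple_P[OF lV x_Vj Vj \<mu> lam0 lam1])
  have "mod_hom (whole_alg sc) ?P ?M ?F" by (rule P_extend[OF lV x_Vj lH \<phi>])
  then have F: "mod_hom H\<^sub>1 ?P M ?F" by (rule mod_hom_corner)
  \<comment> \<open>With \<open>v\<close> in degree 0 only the term \<open>k = 0\<close> survives,
    and it equals \<open>\<phi> v\<close>.\<close>
  let ?u = "\<lambda>k. if k = (0::nat) then v else 0"
  have u: "?u \<in> mod_space ?P" using v n_pos by (auto simp: P_mod_def)
  have "?F ?u = (\<Sum>k<n. if k = 0 then \<phi> v else 0)"
    using M.act_unit[of "\<phi> v"] \<phi>vM linear_on_zero[OF lV lin] by (intro sum.cong) auto
  then have F_nonzero: "?F ?u \<noteq> 0" using \<phi>v n_ge by simp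
  have lP: "left_module H\<^sub>1 ?P" by (rule left_module_P_corner[OF lV x_Vj lam1])
  have "mod_iso H\<^sub>1 M ?P"
    by (rule mod_iso_sym[OF lP mod_iso_if_simple[OF P M F u]]) (rule F_nonzero)
  with j(1) lam1 show ?thesis by blast
qed

end

theorem theorem2p5:
  fixes G :: "('g, 'b) monoid_scheme"
    and \<chi> :: "'g \<Rightarrow> 'k::{alg_closed_field, field_char_0}"
    and g :: 'g and n r :: nat
    and sc :: "'k \<Rightarrow> 'a::ring_1 \<Rightarrow> 'a" and \<iota> :: "'g \<Rightarrow> 'a" and y :: 'a
    and \<Omega> :: "'i set" and V :: "'i \<Rightarrow> ('k, 'a, 'v::ab_group_add) lmod" and lam :: "'i \<Rightarrow> 'k"
  defines "H \<equiv> whole_alg sc"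
    and "e \<equiv> datum_idem G g n r sc \<iota>"
    and "H\<^sub>1 \<equiv> corner_alg sc (1 - datum_idem G g n r sc \<iota>)"
    and "\<Omega>\<^sub>1 \<equiv> {i \<in> \<Omega>. lam i \<noteq> 1}"
    and "P \<equiv> (\<lambda>j. P_mod G \<chi> n sc \<iota> y (V j) (lam j))"
  assumes datum: "group_datum G \<chi> g n"
    and order_g: "group.ord G g = n * r" "r > 1"
    and alg: "datum_algebra G \<chi> g n sc \<iota> y"
    and simples: "complete_set_of_simples (group_alg G sc \<iota>) \<Omega> V"
    and scalars: "\<forall>i\<in>\<Omega>. lam i \<noteq> 0 \<and>
      (\<forall>v\<in>mod_space (V i). mod_act (V i) (\<iota> (g [^]\<^bsub>G\<^esub> n)) v = mod_scale (V i) (lam i) v)"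
  shows
    "(\<forall>j\<in>\<Omega>\<^sub>1. fd_module H\<^sub>1 (P j) \<and> simple_module H\<^sub>1 (P j) \<and>
        projective_module TYPE('n::ab_group_add) TYPE('l::ab_group_add) H\<^sub>1 (P j)) \<and>
     (\<forall>M :: ('k, 'a, 'm::ab_group_add) lmod.
        fd_module H\<^sub>1 M \<and> simple_module H\<^sub>1 M \<longrightarrow> (\<exists>j\<in>\<Omega>\<^sub>1. mod_iso H\<^sub>1 M (P j))) \<and>
     semisimple_algebra H\<^sub>1 \<and>
     jacobson_radical H = principal_ideal H (y * e)"
proof -
  interpret D: group_datum_algebra G \<chi> g n r sc \<iota> y
    using datum order_g alg by unfold_locales auto
  \<comment> \<open>Algebraic closedness enters here: an n-th root of \<open>lam i\<close> lets the
    possible scalars of \<open>g\<close> be listed.\<close>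
  have root: "\<exists>\<mu>. \<mu> ^ n = lam i" for i
    using nth_root_exists[of n "lam i"] D.n_pos by blast
  have x_V: "mod_act (V i) D.x v = mod_scale (V i) (lam i) v" if "i \<in> \<Omega>" "v \<in> mod_space (V i)" for i v
    using scalars that by (simp add: D.x_def)
  have "fd_module H\<^sub>1 (P j) \<and> simple_module H\<^sub>1 (P j) \<and>
      projective_module TYPE('n) TYPE('l) H\<^sub>1 (P j)" if "j \<in> \<Omega>\<^sub>1" for j
  proof -
    from that have j: "j \<in> \<Omega>" "lam j \<noteq> 1" "lam j \<noteq> 0" using scalars by (auto simp: \<Omega>\<^sub>1_def)
    have fd: "fd_module D.GA (V j)" and simple: "simple_module D.GA (V j)"
      using simples j(1) by (auto simp: complete_set_of_simples_def)
    then have lV: "left_module D.GA (V j)" by (simp add: simple_module_def)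
    obtain \<mu> where \<mu>: "\<mu> ^ n = lam j" using root by blast
    note P = D.left_module_P_corner[OF lV x_V[OF j(1)] j(2)]
    show ?thesis
      unfolding H\<^sub>1_def P_def
      using D.fd_P[OF lV x_V[OF j(1)] fd j(2)] D.simple_P[OF lV x_V[OF j(1)] simple \<mu> j(3,2)]
        D.projective_module_corner[OF P] by blast
  qed
  moreover have "\<exists>j\<in>\<Omega>\<^sub>1. mod_iso H\<^sub>1 M (P j)" if "fd_module H\<^sub>1 M" "simple_module H\<^sub>1 M"
    for M :: "('k, 'a, 'm) lmod"
    using D.simple_corner_module_iso_P[of M \<Omega> V lam] that simples x_V scalars root
    unfolding H\<^sub>1_def P_def \<Omega>\<^sub>1_def by blast
  moreover have "semisimple_algebra H\<^sub>1"
    unfolding H\<^sub>1_def by (rule D.semisimple_corner)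
  moreover have "jacobson_radical H = principal_ideal H (y * e)"
    unfolding H_def e_def by (rule D.jacobson_radical_eq)
  ultimately show ?thesis by blast
qed

end
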